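(* Let $k\ge 3$ and let $n$ be the input length. Consider the $k$-party promise function $\mathrm{GP}_k$ defined on $k$-tuples of $n$-bit strings $x_1,\dots,x_k$ satisfying $|x_1\oplus\dots\oplus x_k|\notin[n/3,2n/3]$, by $\mathrm{GP}_k(x_1,\dots,x_k)=0$ if $|x_1\oplus\dots\oplus x_k|<n/2$ and $\mathrm{GP}_k(x_1,\dots,x_k)=1$ otherwise. Then: (a) Using (unrestricted) shared randomness, $\mathrm{GP}_k$ can be solved by a classical $k$-party SMP protocol of cost $k$ in which each player sends one bit. (b) For every $2\le t\le k-1$, in the $k$-party SMP model with quantum communication and $t$-shared randomness, the communication complexity of $\mathrm{GP}_k$ is $\Omega(k n^{1-t/k})$. (c) In particular, in the $k$-party SMP model with quantum communication and without shared randomness, the communication complexity of $\mathrm{GP}_k$ is $\Omega(k n^{1-2/k})$.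
   Context: For a bit string $x$, $|x|$ denotes its Hamming weight and $\oplus$ denotes bitwise XOR. The $k$-party SMP model (number-in-hand): players $A_1,\dots,A_k$, where $A_i$ receives $x_i\in\{0,1\}^n$, each send one message to a referee who computes the output; the cost is the total length of the messages (in qubits, for quantum messages, where the referee may apply any quantum measurement). A protocol solves $\mathrm{GP}_k$ if on every input satisfying the promise the referee answers correctly with probability at least $2/3$. Unrestricted shared randomness: all players see the same random string, independent of the input. $t$-shared randomness ($2\le t\le k$): for each set $S\subseteq[k]$ with $|S|=t$ there is an independent random string $R_S$ (of arbitrary length, independent of the input) known exactly to the players in $S$. Without shared randomness, players have only private randomness. *)

theory Defs
  imports "HOL-Probability.Probability"
begin

definition xor_weight :: "nat \<Rightarrow> nat \<Rightarrow> (nat \<Rightarrow> bool list) \<Rightarrow> nat" where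
  "xor_weight k n x = card {j. j < n \<and> odd (card {i. i < k \<and> x i ! j})}"

definition GP_promise :: "nat \<Rightarrow> nat \<Rightarrow> (nat \<Rightarrow> bool list) \<Rightarrow> bool" where
  "GP_promise k n x \<longleftrightarrow> (\<forall>i<k. length (x i) = n) \<and>
     (real (xor_weight k n x) < real n / 3 \<or> real (xor_weight k n x) > 2 * real n / 3)"

definition GP :: "nat \<Rightarrow> nat \<Rightarrow> (nat \<Rightarrow> bool list) \<Rightarrow> bool" where
  "GP k n x \<longleftrightarrow> \<not> (real (xor_weight k n x) < real n / 2)"

definition classical_one_bit_SMP_solves_GP :: "nat \<Rightarrow> nat \<Rightarrow> bool" where
  "classical_one_bit_SMP_solves_GP k n \<longleftrightarrow>
     (\<exists>(R :: nat pmf) (msg :: nat \<Rightarrow> nat \<Rightarrow> bool list \<Rightarrow> bool) (ref :: (nat \<Rightarrow> bool) \<Rightarrow> bool).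
        \<forall>x. GP_promise k n x \<longrightarrow>
          measure_pmf.prob R {r. ref (\<lambda>i. if i < k then msg i r (x i) else False) = GP k n x} \<ge> 2/3)"

definition psd_on :: "'a set \<Rightarrow> ('a \<Rightarrow> 'a \<Rightarrow> complex) \<Rightarrow> bool" where
  "psd_on M A \<longleftrightarrow> (\<forall>v :: 'a \<Rightarrow> complex.
      (\<Sum>a\<in>M. \<Sum>b\<in>M. cnj (v a) * A a b * v b) \<in> \<real> \<and>
      0 \<le> Re (\<Sum>a\<in>M. \<Sum>b\<in>M. cnj (v a) * A a b * v b))"

(* density matrix of dimension d (mixed state; covers private randomness) *)
definition density :: "nat \<Rightarrow> (nat \<Rightarrow> nat \<Rightarrow> complex) \<Rightarrow> bool" where
  "density d \<rho> \<longleftrightarrow> psd_on {..<d} \<rho> \<and> (\<Sum>a<d. \<rho> a a) = 1"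

(* basis of the tensor product of the k messages, player i sending m i qubits *)
definition multi_idx :: "nat \<Rightarrow> (nat \<Rightarrow> nat) \<Rightarrow> (nat \<Rightarrow> nat) set" where
  "multi_idx k m = (\<Pi>\<^sub>E i\<in>{..<k}. {..<2 ^ m i})"

definition tsubsets :: "nat \<Rightarrow> nat \<Rightarrow> nat set set" where
  "tsubsets k t = {S. S \<subseteq> {..<k} \<and> card S = t}"

(* k-party quantum SMP protocol in which player i sends m i qubits, with shared randomness:
   for each S in the family Sh an independent random string R_S (distribution P S over nat,
   i.e. over finite strings) known exactly to the players in S.  Player i's message is a
   density matrix rho i (x i) r depending on x i and on the R_S with i in S only.
   The referee applies a two-outcome POVM E on the tensor product of the messages.
   Sh = tsubsets k t : t-shared randomness;  Sh = {} : no shared randomness. *)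
definition quantum_SMP_solves_GP ::
    "nat \<Rightarrow> nat \<Rightarrow> nat set set \<Rightarrow> (nat \<Rightarrow> nat) \<Rightarrow> bool" where
  "quantum_SMP_solves_GP k n Sh m \<longleftrightarrow>
     (\<exists>(P :: nat set \<Rightarrow> nat pmf)
       (\<rho> :: nat \<Rightarrow> bool list \<Rightarrow> (nat set \<Rightarrow> nat) \<Rightarrow> nat \<Rightarrow> nat \<Rightarrow> complex)
       (E :: bool \<Rightarrow> (nat \<Rightarrow> nat) \<Rightarrow> (nat \<Rightarrow> nat) \<Rightarrow> complex).
        (\<forall>i<k. \<forall>y r. length y = n \<longrightarrow> density (2 ^ m i) (\<rho> i y r)) \<and>
        psd_on (multi_idx k m) (E False) \<and> psd_on (multi_idx k m) (E True) \<and>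
        (\<forall>a\<in>multi_idx k m. \<forall>b\<in>multi_idx k m.
            E False a b + E True a b = (if a = b then 1 else 0)) \<and>
        (\<forall>x. GP_promise k n x \<longrightarrow>
           measure_pmf.expectation (Pi_pmf Sh 0 P)
             (\<lambda>r. Re (\<Sum>a\<in>multi_idx k m. \<Sum>b\<in>multi_idx k m.
                   E (GP k n x) a b *
                   (\<Prod>i<k. \<rho> i (x i) (\<lambda>S. if i \<in> S then r S else 0) (b i) (a i))))
           \<ge> 2/3))"

end

theory Submission
  imports Defs "Jordan_Normal_Form.Spectral_Radius"
begin

text \<open>
  Part (a): the shared random string is a uniform coordinate \<open>j\<close>, each player sends \<open>x\<^sub>i ! j\<close>, and
  the referee outputs the parity.

  Parts (b) and (c): for a set \<open>B\<close> of more than \<open>2n/3\<close> coordinates, forcing the parity of the inputs to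
  be constantly 0 or constantly 1 on \<open>B\<close>, with everything else uniform, always satisfies the promise,
  so the two acceptance probabilities differ by at least \<open>1/3\<close>. We walk from the uniform
  distribution to these two by forcing one coordinate at a time. Forcing \<open>j\<close> after \<open>J\<close> changes the
  acceptance probability by a correlation of the \<open>k\<close> level-one coefficients at \<open>j\<close> of the messages, with the inputs
  on \<open>J\<close> fixed. Cauchy-Schwarz over the inputs on \<open>J\<close> (where the players are only correlated through
  one parity) and Finner's inequality over the shared strings (each seen by \<open>t\<close> players) bound this change by
  \<open>\<Prod>\<^sub>i (a i j) powr (1/t)\<close>, where \<open>a i j\<close> is the mean square trace norm of the coefficient of player \<open>i\<close>.
  A level-one inequality gives \<open>\<Sum>\<^sub>j a i j \<le> 24 m\<^sub>i\<close>, so if the next coordinate is chosen greedily, then by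
  AM-GM each step costs at most \<open>(72 \<mu> / n) powr (k/t)\<close> with \<open>\<mu>\<close> the average message length. There are at
  most \<open>n\<close> steps, hence \<open>\<mu>\<close> is at least of order \<open>n powr (1 - t/k)\<close>.
\<close>

section \<open>Spectral decomposition of Hermitian matrices\<close>

text \<open>The parity of all \<open>k\<close> inputs at a coordinate is invisible to any
  \<open>k - 1\<close> players, so forcing it changes the acceptance probability only through a
  product in which every message contributes its own coefficient at that coordinate. The obstacle is
  that the inputs on coordinates forced earlier are no longer independent. Their dependence is one
  parity per forced coordinate. Expanded in characters it leaves a single sum over \<open>T\<close>
  of products of \<open>k\<close> Fourier coefficients, one per player, and for
  \<open>k \<ge> 2\<close> such a sum is at most the product of the root mean squares.

  The exponent \<open>1/t\<close> arises because Finner's inequality asks for \<open>L^t\<close>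
  norms, while the level-one inequality controls second moments. For quantities in [0,1] and
  \<open>t \<ge> 2\<close> the \<open>t\<close>-th moment is at most the second.

  Quantum messages force the level-one inequality to be one about trace norms. The dimension
  \<open>2^m\<close> enters it only as a factor in front of a \<open>2m\<close>-th moment, so after
  taking roots it costs a constant.

  Constants: 72 is 3 times 24 because at least \<open>n/3\<close> coordinates stay free at every
  step; 6 comes from a gap of \<open>1/3\<close> shared by two walks; 432 is 6 times 72.\<close>

definition hermitian_on :: "nat \<Rightarrow> (nat \<Rightarrow> nat \<Rightarrow> complex) \<Rightarrow> bool" where
  "hermitian_on d M \<longleftrightarrow> (\<forall>a<d. \<forall>b<d. cnj (M a b) = M b a)"

text \<open>Both relations are recorded: the columns serve as orthonormal eigenvectors, and the row
  relation is the resolution of the identity by them.\<close>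

definition unitary_on :: "nat \<Rightarrow> (nat \<Rightarrow> nat \<Rightarrow> complex) \<Rightarrow> bool" where
  "unitary_on d U \<longleftrightarrow>
     (\<forall>l<d. \<forall>l'<d. (\<Sum>a<d. cnj (U a l) * U a l') = of_bool (l = l')) \<and>
     (\<forall>a<d. \<forall>b<d. (\<Sum>l<d. U a l * cnj (U b l)) = of_bool (a = b))"

definition mmul :: "nat \<Rightarrow> (nat \<Rightarrow> nat \<Rightarrow> complex) \<Rightarrow> (nat \<Rightarrow> nat \<Rightarrow> complex) \<Rightarrow> nat \<Rightarrow> nat \<Rightarrow> complex" where
  "mmul d A B = (\<lambda>a b. \<Sum>c<d. A a c * B c b)"

definition diagonalizes :: "nat \<Rightarrow> (nat \<Rightarrow> nat \<Rightarrow> complex) \<Rightarrow> (nat \<Rightarrow> nat \<Rightarrow> complex) \<Rightarrow> (nat \<Rightarrow> real) \<Rightarrow> bool" where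
  "diagonalizes d M U \<mu> \<longleftrightarrow> unitary_on d U \<and>
     (\<forall>a<d. \<forall>b<d. M a b = (\<Sum>l<d. of_real (\<mu> l) * U a l * cnj (U b l)))"

lemma mmul_assoc: "mmul d (mmul d A B) C = mmul d A (mmul d B C)"
proof (intro ext)
  fix a b
  have "mmul d (mmul d A B) C a b = (\<Sum>c<d. \<Sum>e<d. A a e * B e c * C c b)"
    by (simp add: mmul_def sum_distrib_right)
  also have "\<dots> = (\<Sum>e<d. \<Sum>c<d. A a e * B e c * C c b)"
    by (rule sum.swap)
  also have "\<dots> = mmul d A (mmul d B C) a b"
    by (simp add: mmul_def sum_distrib_left mult.assoc)
  finally show "mmul d (mmul d A B) C a b = mmul d A (mmul d B C) a b" .
qed

lemma sum_kronecker:
  fixes f :: "nat \<Rightarrow> complex"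
  assumes "a < d"
  shows "(\<Sum>c<d. of_bool (a = c) * f c) = f a" "(\<Sum>c<d. of_bool (c = a) * f c) = f a"
    "(\<Sum>c<d. f c * of_bool (a = c)) = f a" "(\<Sum>c<d. f c * of_bool (c = a)) = f a"
  using assms by (simp_all add: of_bool_def if_distrib[of "\<lambda>x. x * _"] if_distrib[of "\<lambda>x. _ * x"] cong: if_cong)

lemma unitary_on_mmul:
  assumes A: "unitary_on d A" and B: "unitary_on d B"
  shows "unitary_on d (mmul d A B)"
proof -
  have "(\<Sum>a<d. cnj (mmul d A B a l) * mmul d A B a l') = of_bool (l = l')"
    if l: "l < d" "l' < d" for l l'
  proof -
    have "(\<Sum>a<d. cnj (mmul d A B a l) * mmul d A B a l') =
        (\<Sum>a<d. \<Sum>c<d. \<Sum>e<d. cnj (B c l) * B e l' * (cnj (A a c) * A a e))"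
      unfolding mmul_def cnj_sum sum_product by (intro sum.cong refl) (simp add: mult_ac)
    also have "\<dots> = (\<Sum>c<d. \<Sum>a<d. \<Sum>e<d. cnj (B c l) * B e l' * (cnj (A a c) * A a e))"
      by (rule sum.swap)
    also have "\<dots> = (\<Sum>c<d. \<Sum>e<d. cnj (B c l) * B e l' * (\<Sum>a<d. cnj (A a c) * A a e))"
      by (rule sum.cong[OF refl], subst sum.swap, simp add: sum_distrib_left)
    also have "\<dots> = (\<Sum>c<d. \<Sum>e<d. cnj (B c l) * B e l' * of_bool (c = e))"
      using A by (intro sum.cong refl) (simp add: unitary_on_def)
    also have "\<dots> = (\<Sum>c<d. cnj (B c l) * B c l')"
      by (intro sum.cong refl sum_kronecker) auto
    finally show ?thesis using B l by (simp add: unitary_on_def)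
  qed
  moreover have "(\<Sum>l<d. mmul d A B a l * cnj (mmul d A B b l)) = of_bool (a = b)"
    if l: "a < d" "b < d" for a b
  proof -
    have "(\<Sum>l<d. mmul d A B a l * cnj (mmul d A B b l)) =
        (\<Sum>l<d. \<Sum>c<d. \<Sum>e<d. A a c * cnj (A b e) * (B c l * cnj (B e l)))"
      unfolding mmul_def cnj_sum sum_product by (intro sum.cong refl) (simp add: mult_ac)
    also have "\<dots> = (\<Sum>c<d. \<Sum>l<d. \<Sum>e<d. A a c * cnj (A b e) * (B c l * cnj (B e l)))"
      by (rule sum.swap)
    also have "\<dots> = (\<Sum>c<d. \<Sum>e<d. A a c * cnj (A b e) * (\<Sum>l<d. B c l * cnj (B e l)))"
      by (rule sum.cong[OF refl], subst sum.swap, simp add: sum_distrib_left)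
    also have "\<dots> = (\<Sum>c<d. \<Sum>e<d. A a c * cnj (A b e) * of_bool (c = e))"
      using B by (intro sum.cong refl) (simp add: unitary_on_def)
    also have "\<dots> = (\<Sum>c<d. A a c * cnj (A b c))"
      by (intro sum.cong refl sum_kronecker) auto
    finally show ?thesis using A l by (simp add: unitary_on_def)
  qed
  ultimately show ?thesis by (simp add: unitary_on_def)
qed

text \<open>The complex spectrum is nonempty. An eigenvector is scaled to norm one and its phase
  turned until the entry at 0 is real, as the reflection below requires.\<close>

lemma ex_unit_eigenvector:
  fixes M :: "nat \<Rightarrow> nat \<Rightarrow> complex"
  assumes "d > 0"
  obtains v \<kappa> t where "\<And>a. a < d \<Longrightarrow> (\<Sum>b<d. M a b * v b) = \<kappa> * v a"
    "(\<Sum>a<d. cnj (v a) * v a) = 1" "v 0 = complex_of_real t"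
proof -
  define A where "A = mat d d (\<lambda>(a, b). M a b)"
  have A: "A \<in> carrier_mat d d" by (simp add: A_def)
  from spectrum_non_empty[OF A assms] obtain \<kappa> where "eigenvalue A \<kappa>"
    by (auto simp: spectrum_def)
  then obtain u where u: "u \<in> carrier_vec d" "u \<noteq> 0\<^sub>v d" "A *\<^sub>v u = \<kappa> \<cdot>\<^sub>v u"
    using A by (auto simp: eigenvalue_def eigenvector_def)
  define w where "w a = vec_index u a" for a
  have ev: "(\<Sum>b<d. M a b * w b) = \<kappa> * w a" if "a < d" for a
  proof -
    have "vec_index (A *\<^sub>v u) a = (\<Sum>b<d. M a b * w b)"
      using that u(1) by (simp add: A_def scalar_prod_def w_def atLeast0LessThan)
    then show ?thesis using u that by (simp add: w_def)
  qed
  define N where "N = (\<Sum>a<d. (cmod (w a))\<^sup>2)"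
  obtain a0 where a0: "a0 < d" "w a0 \<noteq> 0"
    using u(1,2) unfolding w_def by (metis carrier_vecD eq_vecI index_zero_vec(1,2))
  have "N > 0" unfolding N_def by (rule sum_pos2[of _ a0]) (use a0 in auto)
  define s where "s = (if w 0 = 0 then 1 else cnj (w 0) / of_real (cmod (w 0)))"
  have s1: "cmod s = 1" by (simp add: s_def norm_divide)
  have s0: "s * w 0 = of_real (cmod (w 0))"
    using complex_norm_square[of "w 0"] by (cases "w 0 = 0") (auto simp: s_def field_simps power2_eq_square)
  define v where "v a = s / of_real (sqrt N) * w a" for a
  show thesis
  proof (rule that[of v \<kappa> "cmod (w 0) / sqrt N"])
    fix a assume "a < d"
    then have "(\<Sum>b<d. M a b * v b) = s / of_real (sqrt N) * (\<kappa> * w a)"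
      by (subst ev[symmetric]) (auto simp: v_def sum_distrib_left mult_ac)
    then show "(\<Sum>b<d. M a b * v b) = \<kappa> * v a" by (simp add: v_def)
  next
    have "(\<Sum>a<d. cnj (v a) * v a) = of_real (\<Sum>a<d. (cmod (v a))\<^sup>2)"
      by (simp add: complex_norm_square mult.commute del: of_real_power)
    also have "(\<Sum>a<d. (cmod (v a))\<^sup>2) = (\<Sum>a<d. (cmod (w a))\<^sup>2 / N)"
      using \<open>N > 0\<close> by (simp add: v_def norm_mult norm_divide s1 power_mult_distrib power_divide)
    also have "\<dots> = 1" using \<open>N > 0\<close> by (simp add: N_def sum_divide_distrib[symmetric])
    finally show "(\<Sum>a<d. cnj (v a) * v a) = 1" by simp
  next
    show "v 0 = complex_of_real (cmod (w 0) / sqrt N)"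
      using s0 by (simp add: v_def)
  qed
qed

text \<open>The Householder reflection exchanging \<open>e\<^sub>0\<close> and \<open>v\<close>; it needs \<open>v 0\<close> to be real.\<close>

lemma ex_unitary_first_column:
  fixes v :: "nat \<Rightarrow> complex"
  assumes d: "d > 0" and v: "(\<Sum>a<d. cnj (v a) * v a) = 1" "v 0 = complex_of_real t"
  obtains Q where "unitary_on d Q" "\<And>a. a < d \<Longrightarrow> Q a 0 = v a"
proof (cases "t = 1")
  case True
  have "(\<Sum>a<d. cnj (v a) * v a) = (\<Sum>a\<in>insert 0 {1..<d}. cnj (v a) * v a)"
    using d by (intro sum.cong) auto
  also have "\<dots> = 1 + of_real (\<Sum>a=1..<d. (cmod (v a))\<^sup>2)"
    using v(2) True by (simp add: complex_norm_square mult.commute del: of_real_power)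
  finally have "complex_of_real (\<Sum>a=1..<d. (cmod (v a))\<^sup>2) = 0"
    unfolding v(1) by (simp del: of_real_sum)
  then have "(\<Sum>a=1..<d. (cmod (v a))\<^sup>2) = 0"
    by (simp only: of_real_eq_0_iff)
  then have z: "v a = 0" if "a \<in> {1..<d}" for a
    using that by (subst (asm) sum_nonneg_eq_0_iff) auto
  show thesis
  proof (rule that[of "\<lambda>a b. of_bool (a = b)"])
    show "unitary_on d (\<lambda>a b. of_bool (a = b))"
      by (auto simp: unitary_on_def sum_kronecker)
    show "of_bool (a = 0) = v a" if "a < d" for a
      using z[of a] that v(2) True by (cases "a = 0") auto
  qed
next
  case False
  \<comment> \<open>The squared norm of \<open>w\<close> is \<open>2 - 2t\<close>, so this factor is
    2 divided by it and \<open>Q\<close> reflects along \<open>w\<close>. For \<open>t = 1\<close>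
    the vector is already the first unit vector and \<open>w\<close> would vanish.\<close>
  define c where "c = complex_of_real (1 / (1 - t))"
  define w where "w a = v a - of_bool (a = 0)" for a
  define Q where "Q a b = of_bool (a = b) - c * w a * cnj (w b)" for a b
  have ww: "(\<Sum>a<d. cnj (w a) * w a) = 2 - 2 * of_real t"
  proof -
    have "(\<Sum>a<d. cnj (w a) * w a) =
      (\<Sum>a<d. cnj (v a) * v a - of_bool (a = 0) * cnj (v a) - of_bool (a = 0) * v a + of_bool (a = 0) * 1)"
      by (intro sum.cong refl) (auto simp: w_def algebra_simps)
    also have "\<dots> = 1 - cnj (v 0) - v 0 + 1"
      using d by (simp only: sum.distrib sum_subtractf v sum_kronecker(2)[OF d])
    finally show ?thesis by (simp add: v(2))
  qed
  have "c * (2 - 2 * of_real t) = of_real (1 / (1 - t) * (2 - 2 * t))"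
    by (simp add: c_def)
  also have "1 / (1 - t) * (2 - 2 * t) = 2"
    using False by (simp add: field_simps)
  finally have c: "c * (2 - 2 * of_real t) = 2" "cnj c = c"
    by (simp_all add: c_def)
  have cw: "c * w a * w 0 = - w a" for a
    using False by (simp add: w_def[of 0] v(2) c_def field_simps)
  have QQ: "(\<Sum>l<d. Q a l * Q l b) = of_bool (a = b)" if "a < d" "b < d" for a b
  proof -
    have "(\<Sum>l<d. Q a l * Q l b) = (\<Sum>l<d. of_bool (a = l) * of_bool (l = b)
        - of_bool (a = l) * (c * w l * cnj (w b)) - c * w a * cnj (w l) * of_bool (l = b)
        + c * c * w a * cnj (w b) * (cnj (w l) * w l))"
      by (intro sum.cong refl) (simp add: Q_def algebra_simps)
    also have "\<dots> = of_bool (a = b) - c * w a * cnj (w b) - c * w a * cnj (w b)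
       + c * c * w a * cnj (w b) * (2 - 2 * of_real t)"
      using that by (simp only: sum.distrib sum_subtractf sum_distrib_left[symmetric] ww
          sum_kronecker(1)[OF that(1)] sum_kronecker(4)[OF that(2)])
    also have "c * c * w a * cnj (w b) * (2 - 2 * of_real t) = c * w a * cnj (w b) * (c * (2 - 2 * of_real t))"
      by (simp add: mult_ac)
    finally show ?thesis by (simp add: c)
  qed
  have cnjQ: "cnj (Q a b) = Q b a" for a b
    by (auto simp: Q_def c mult_ac)
  show thesis
  proof (rule that[of Q])
    show "unitary_on d Q" by (simp add: unitary_on_def cnjQ QQ)
    have w0: "cnj (w 0) = w 0" by (simp add: w_def v(2))
    show "Q a 0 = v a" if "a < d" for a
      using cw[of a] by (simp add: Q_def w0) (simp add: w_def)
  qed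
qed

text \<open>Deflation: in a unitary basis that starts with a unit eigenvector, the first column is a
  multiple of the first unit vector, and Hermitian symmetry clears the first row too. The induction
  hypothesis handles the remaining block.\<close>

lemma hermitian_diagonalizable:
  assumes "hermitian_on d M"
  obtains U \<mu> where "diagonalizes d M U \<mu>"
proof -
  have "\<exists>U \<mu>. diagonalizes d M U \<mu>" using assms
  proof (induction d arbitrary: M)
    case 0
    then show ?case by (simp add: diagonalizes_def unitary_on_def)
  next
    case (Suc d)
    define D where "D = Suc d"
    have D0: "0 < D" by (simp add: D_def)
    have hM: "hermitian_on D M" using Suc.prems by (simp add: D_def)
    obtain v \<kappa> t where v: "\<And>a. a < D \<Longrightarrow> (\<Sum>b<D. M a b * v b) = \<kappa> * v a"
      "(\<Sum>a<D. cnj (v a) * v a) = 1" "v 0 = complex_of_real t"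
      using ex_unit_eigenvector[OF D0, of M] by blast
    obtain Q where Q: "unitary_on D Q" "\<And>a. a < D \<Longrightarrow> Q a 0 = v a"
      using ex_unitary_first_column[OF D0 v(2,3)] by blast
    define Qa where "Qa a b = cnj (Q b a)" for a b
    have QQa: "mmul D Q Qa a b = of_bool (a = b)" "mmul D Qa Q a b = of_bool (a = b)"
      if "a < D" "b < D" for a b
      using Q(1) that by (simp_all add: mmul_def Qa_def unitary_on_def)
    define N where "N = mmul D Qa (mmul D M Q)"
    have N0: "N a 0 = \<kappa> * of_bool (a = 0)" if "a < D" for a
    proof -
      have "N a 0 = (\<Sum>c<D. Qa a c * (\<kappa> * Q c 0))"
        unfolding N_def mmul_def using v(1) Q(2) by (intro sum.cong refl) simp
      also have "\<dots> = \<kappa> * mmul D Qa Q a 0"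
        by (simp add: mmul_def sum_distrib_left mult_ac)
      finally show ?thesis using that QQa(2)[of a 0] by simp
    qed
    have Nh: "hermitian_on D N"
      unfolding hermitian_on_def
    proof (intro allI impI)
      fix a b assume ab: "a < D" "b < D"
      have "cnj (N a b) = (\<Sum>c<D. \<Sum>e<D. Q c a * (cnj (M c e) * Qa b e))"
        by (simp add: N_def mmul_def Qa_def sum_distrib_left)
      also have "\<dots> = (\<Sum>c<D. \<Sum>e<D. Q c a * (M e c * Qa b e))"
        using hM by (intro sum.cong refl) (simp add: hermitian_on_def)
      also have "\<dots> = (\<Sum>e<D. \<Sum>c<D. Q c a * (M e c * Qa b e))"
        by (rule sum.swap)
      also have "\<dots> = N b a"
        by (simp add: N_def mmul_def sum_distrib_left mult_ac)
      finally show "cnj (N a b) = N b a" by simp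
    qed
    \<comment> \<open>The eigenvalue has become a diagonal entry of a Hermitian matrix, hence it is
      real.\<close>
    have "cnj (N 0 0) = N 0 0" using Nh D0 unfolding hermitian_on_def by blast
    then have N00: "complex_of_real (Re \<kappa>) = \<kappa>"
      using N0[OF D0] by (simp add: complex_eq_iff)
    have N0': "N 0 (Suc b) = 0" if "b < d" for b
    proof -
      have "cnj (N (Suc b) 0) = N 0 (Suc b)"
        using Nh that unfolding hermitian_on_def D_def by blast
      then show ?thesis using N0[of "Suc b"] that by (simp add: D_def del: complex_cnj_cancel_iff)
    qed
    have "hermitian_on d (\<lambda>a b. N (Suc a) (Suc b))"
      using Nh by (simp add: hermitian_on_def D_def)
    from Suc.IH[OF this] obtain U \<mu> where U: "unitary_on d U"
      "\<And>a b. a < d \<Longrightarrow> b < d \<Longrightarrow> N (Suc a) (Suc b) = (\<Sum>l<d. of_real (\<mu> l) * U a l * cnj (U b l))"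
      unfolding diagonalizes_def by blast
    define V where "V a l = (case a of 0 \<Rightarrow> (case l of 0 \<Rightarrow> 1 | Suc _ \<Rightarrow> 0)
       | Suc a \<Rightarrow> (case l of 0 \<Rightarrow> 0 | Suc l \<Rightarrow> U a l))" for a l
    define \<nu> where "\<nu> = case_nat (Re \<kappa>) \<mu>"
    have Vs: "V 0 0 = 1" "V 0 (Suc l) = 0" "V (Suc a) 0 = 0" "V (Suc a) (Suc l) = U a l"
      and \<nu>s: "\<nu> 0 = Re \<kappa>" "\<nu> (Suc l) = \<mu> l" for a l
      by (simp_all add: V_def \<nu>_def)
    have Suc_cases: "a = 0 \<or> (\<exists>a'<d. a = Suc a')" if "a < Suc d" for a
      using that by (cases a) auto
    have V: "unitary_on D V"
      unfolding unitary_on_def D_def sum.lessThan_Suc_shift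
    proof (intro conjI allI impI)
      fix l l' assume "l < Suc d" "l' < Suc d"
      then show "cnj (V 0 l) * V 0 l' + (\<Sum>i<d. cnj (V (Suc i) l) * V (Suc i) l') = of_bool (l = l')"
        using Suc_cases[of l] Suc_cases[of l'] U(1) by (auto simp: Vs unitary_on_def)
    next
      fix a b assume "a < Suc d" "b < Suc d"
      then show "V a 0 * cnj (V b 0) + (\<Sum>i<d. V a (Suc i) * cnj (V b (Suc i))) = of_bool (a = b)"
        using Suc_cases[of a] Suc_cases[of b] U(1) by (auto simp: Vs unitary_on_def)
    qed
    have NV: "N a b = (\<Sum>l<D. of_real (\<nu> l) * V a l * cnj (V b l))" if "a < D" "b < D" for a b
      unfolding D_def sum.lessThan_Suc_shift
      using Suc_cases[of a] Suc_cases[of b] that[unfolded D_def] D0 N0[OF D0] N0[OF that(1)] N0' N00 U(2)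
      by (auto simp: Vs \<nu>s)
    have MN: "M a b = mmul D Q (mmul D N Qa) a b" if "a < D" "b < D" for a b
    proof -
      have "mmul D Q (mmul D N Qa) a b = mmul D (mmul D (mmul D Q Qa) M) (mmul D Q Qa) a b"
        by (simp add: N_def mmul_assoc)
      also have "\<dots> = (\<Sum>c<D. mmul D (mmul D Q Qa) M a c * of_bool (c = b))"
        unfolding mmul_def[of _ "mmul _ _ M"] using that
        by (intro sum.cong refl) (simp add: QQa)
      also have "\<dots> = (\<Sum>e<D. mmul D Q Qa a e * M e b)"
        using that by (simp only: sum_kronecker mmul_def[of _ _ M])
      also have "\<dots> = (\<Sum>e<D. of_bool (a = e) * M e b)"
        using that by (intro sum.cong refl) (simp add: QQa)
      also have "\<dots> = M a b"
        using that by (simp only: sum_kronecker)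
      finally show ?thesis by simp
    qed
    have "M a b = (\<Sum>l<D. of_real (\<nu> l) * mmul D Q V a l * cnj (mmul D Q V b l))"
      if "a < D" "b < D" for a b
    proof -
      have "M a b = (\<Sum>c<D. \<Sum>e<D. Q a c * ((\<Sum>l<D. of_real (\<nu> l) * V c l * cnj (V e l)) * cnj (Q b e)))"
        unfolding MN[OF that] mmul_def sum_distrib_left
        by (intro sum.cong refl) (simp only: NV lessThan_iff Qa_def)
      also have "\<dots> = (\<Sum>c<D. \<Sum>e<D. \<Sum>l<D. of_real (\<nu> l) * (Q a c * V c l) * cnj (Q b e * V e l))"
        by (intro sum.cong refl) (simp add: sum_distrib_left sum_distrib_right mult_ac)
      also have "\<dots> = (\<Sum>c<D. \<Sum>l<D. \<Sum>e<D. of_real (\<nu> l) * (Q a c * V c l) * cnj (Q b e * V e l))"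
        by (rule sum.cong[OF refl], rule sum.swap)
      also have "\<dots> = (\<Sum>l<D. \<Sum>c<D. \<Sum>e<D. of_real (\<nu> l) * (Q a c * V c l) * cnj (Q b e * V e l))"
        by (rule sum.swap)
      also have "\<dots> = (\<Sum>l<D. of_real (\<nu> l) * mmul D Q V a l * cnj (mmul D Q V b l))"
        by (rule sum.cong[OF refl], simp only: mmul_def cnj_sum mult.assoc sum_product, simp only: sum_distrib_left)
      finally show ?thesis .
    qed
    then have "diagonalizes D M (mmul D Q V) \<nu>"
      unfolding diagonalizes_def using unitary_on_mmul[OF Q(1) V] by blast
    then show ?case unfolding D_def by blast
  qed
  then show thesis using that by blast
qed

section \<open>Characters of the Boolean cube\<close>

text \<open>A bit string is encoded as the set of coordinates that carry a 1. \<open>eps j X\<close>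
  is then the sign of bit \<open>j\<close>, and \<open>chi\<close> below is the Walsh
  character.\<close>

definition eps :: "nat \<Rightarrow> nat set \<Rightarrow> real" where
  "eps j X = (if j \<in> X then -1 else 1)"

definition chi :: "nat set \<Rightarrow> nat set \<Rightarrow> real" where
  "chi T X = (\<Prod>j\<in>T. eps j X)"

lemma eps_sq [simp]: "eps j X * eps j X = 1"
  by (simp add: eps_def)

lemma abs_eps [simp]: "\<bar>eps j X\<bar> = 1"
  by (simp add: eps_def)

lemma sum_Pow_prod:
  fixes g h :: "nat \<Rightarrow> real"
  assumes "finite A"
  shows "(\<Sum>X\<in>Pow A. \<Prod>j\<in>A. if j \<in> X then g j else h j) = (\<Prod>j\<in>A. g j + h j)"
proof -
  have "(\<Prod>j\<in>A. if j \<in> X then g j else h j) = prod g X * prod h (A - X)" if "X \<in> Pow A" for X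
  proof -
    have "A \<inter> X = X" "A \<inter> - X = A - X" using that by auto
    then show ?thesis using assms by (simp add: prod.If_cases)
  qed
  then show ?thesis by (simp add: prod_add[OF assms])
qed

lemma sum_chi:
  assumes "finite A" "T \<subseteq> A"
  shows "(\<Sum>X\<in>Pow A. chi T X) = (if T = {} then 2 ^ card A else 0)"
proof -
  have "chi T X = (\<Prod>j\<in>A. if j \<in> X then (if j \<in> T then -1 else 1) else 1)" for X
    unfolding chi_def using assms by (intro prod.mono_neutral_cong_left) (auto simp: eps_def)
  then have "(\<Sum>X\<in>Pow A. chi T X) = (\<Prod>j\<in>A. (if j \<in> T then -1 else 1) + 1)"
    using sum_Pow_prod[OF assms(1), of "\<lambda>j. if j \<in> T then -1 else 1" "\<lambda>_. 1"] by simp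
  also have "\<dots> = (if T = {} then 2 ^ card A else 0)"
    using assms by (auto intro!: prod_zero)
  finally show ?thesis .
qed

text \<open>Both sides are -1 to the size of the intersection. The symmetry lets orthogonality be
  summed over either argument.\<close>

lemma chi_symmetric: "finite S \<Longrightarrow> finite T \<Longrightarrow> chi S T = chi T S"
  by (simp add: chi_def eps_def prod.If_cases Int_commute)

lemma chi_mult_chi:
  assumes "finite X" "finite Y"
  shows "chi T X * chi T Y = chi T (sym_diff X Y)"
  unfolding chi_def prod.distrib[symmetric] by (intro prod.cong) (auto simp: eps_def)

lemma parseval:
  assumes A: "finite A"
  shows "(\<Sum>T\<in>Pow A. (\<Sum>X\<in>Pow A. chi T X * f X)\<^sup>2) = 2 ^ card A * (\<Sum>X\<in>Pow A. (f X)\<^sup>2)"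
proof -
  have fin: "finite X" if "X \<in> Pow A" for X using that A finite_subset by auto
  have *: "(\<Sum>T\<in>Pow A. chi T X * chi T Y) = (if X = Y then 2 ^ card A else 0)"
    if "X \<in> Pow A" "Y \<in> Pow A" for X Y
  proof -
    have "(\<Sum>T\<in>Pow A. chi T X * chi T Y) = (\<Sum>T\<in>Pow A. chi (sym_diff X Y) T)"
      using that fin by (intro sum.cong refl) (auto simp: chi_mult_chi intro!: chi_symmetric)
    also have "\<dots> = (if sym_diff X Y = {} then 2 ^ card A else 0)"
      using that by (intro sum_chi A) auto
    finally show ?thesis by auto
  qed
  have "(\<Sum>T\<in>Pow A. (\<Sum>X\<in>Pow A. chi T X * f X)\<^sup>2) =
      (\<Sum>T\<in>Pow A. \<Sum>X\<in>Pow A. \<Sum>Y\<in>Pow A. f X * f Y * (chi T X * chi T Y))"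
    by (simp add: power2_eq_square sum_product mult_ac)
  also have "\<dots> = (\<Sum>X\<in>Pow A. \<Sum>T\<in>Pow A. \<Sum>Y\<in>Pow A. f X * f Y * (chi T X * chi T Y))"
    by (rule sum.swap)
  also have "\<dots> = (\<Sum>X\<in>Pow A. \<Sum>Y\<in>Pow A. f X * f Y * (\<Sum>T\<in>Pow A. chi T X * chi T Y))"
    by (rule sum.cong[OF refl], subst sum.swap, simp add: sum_distrib_left)
  also have "\<dots> = (\<Sum>X\<in>Pow A. \<Sum>Y\<in>Pow A. if X = Y then f X * f Y * 2 ^ card A else 0)"
    by (intro sum.cong refl) (simp add: *)
  also have "\<dots> = (\<Sum>X\<in>Pow A. f X * f X * 2 ^ card A)"
    using A by (intro sum.cong refl) (simp add: sum.delta)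
  finally show ?thesis by (simp add: sum_distrib_left power2_eq_square mult_ac)
qed

section \<open>Sums of products of several functions\<close>

text \<open>Of the tuples in the expanded right-hand side the left keeps only the constant ones. For
  empty \<open>I\<close> the comparison would be \<open>card S\<close> against 1.\<close>

lemma sum_prod_le_prod_sum:
  fixes h :: "'i \<Rightarrow> 's \<Rightarrow> real"
  assumes "finite I" "I \<noteq> {}" "finite S" "\<And>i s. i \<in> I \<Longrightarrow> s \<in> S \<Longrightarrow> 0 \<le> h i s"
  shows "(\<Sum>s\<in>S. \<Prod>i\<in>I. h i s) \<le> (\<Prod>i\<in>I. \<Sum>s\<in>S. h i s)"
  using assms
proof (induction I rule: finite_ne_induct)
  case (singleton i)
  then show ?case by simp
next
  case (insert i I)
  have "(\<Sum>s\<in>S. \<Prod>i\<in>insert i I. h i s) = (\<Sum>s\<in>S. h i s * (\<Prod>i\<in>I. h i s))"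
    using insert by simp
  also have "\<dots> \<le> (\<Sum>s\<in>S. h i s * (\<Sum>s\<in>S. \<Prod>i\<in>I. h i s))"
    using insert.prems insert.hyps
    by (intro sum_mono mult_left_mono member_le_sum) (auto intro!: prod_nonneg)
  also have "\<dots> = (\<Sum>s\<in>S. h i s) * (\<Sum>s\<in>S. \<Prod>i\<in>I. h i s)"
    by (simp add: sum_distrib_right)
  also have "\<dots> \<le> (\<Sum>s\<in>S. h i s) * (\<Prod>i\<in>I. \<Sum>s\<in>S. h i s)"
    using insert by (intro mult_left_mono sum_nonneg) auto
  finally show ?case using insert by simp
qed

lemma sqrt_prod: "sqrt (\<Prod>i\<in>I. f i) = (\<Prod>i\<in>I. sqrt (f i))"
  by (induction I rule: infinite_finite_induct) (simp_all add: real_sqrt_mult)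

text \<open>One function is split off by Cauchy-Schwarz. At least one function remains because
  \<open>card I \<ge> 2\<close>, so the sum of the products of squares is at most the product of the
  sums.\<close>

lemma sum_prod_le_L2:
  fixes g :: "'i \<Rightarrow> 's \<Rightarrow> real"
  assumes I: "finite I" "card I \<ge> 2" and S: "finite S"
  shows "(\<Sum>s\<in>S. \<Prod>i\<in>I. \<bar>g i s\<bar>) \<le> (\<Prod>i\<in>I. sqrt (\<Sum>s\<in>S. (g i s)\<^sup>2))"
proof -
  obtain i where i: "i \<in> I" using I by fastforce
  define K where "K = I - {i}"
  have "card K \<ge> 1" using I i by (simp add: K_def)
  then have "K \<noteq> {}" by auto
  moreover have "finite K" "I = insert i K" "i \<notin> K"
    using I i by (auto simp: K_def)
  ultimately have K: "finite K" "K \<noteq> {}" "I = insert i K" "i \<notin> K" by blast+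
  have "(\<Sum>s\<in>S. \<Prod>i\<in>I. \<bar>g i s\<bar>) = (\<Sum>s\<in>S. \<bar>g i s\<bar> * (\<Prod>i\<in>K. \<bar>g i s\<bar>))"
    using K by simp
  also have "\<dots> \<le> sqrt (\<Sum>s\<in>S. (g i s)\<^sup>2) * sqrt (\<Sum>s\<in>S. (\<Prod>i\<in>K. \<bar>g i s\<bar>)\<^sup>2)"
    using Cauchy_Schwarz_ineq_sum[of "\<lambda>s. \<bar>g i s\<bar>" "\<lambda>s. \<Prod>i\<in>K. \<bar>g i s\<bar>" S]
    by (simp add: real_le_rsqrt flip: real_sqrt_mult)
  also have "(\<Sum>s\<in>S. (\<Prod>i\<in>K. \<bar>g i s\<bar>)\<^sup>2) = (\<Sum>s\<in>S. \<Prod>i\<in>K. (g i s)\<^sup>2)"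
    by (simp add: prod_power_distrib)
  also have "\<dots> \<le> (\<Prod>i\<in>K. \<Sum>s\<in>S. (g i s)\<^sup>2)"
    using K S by (intro sum_prod_le_prod_sum) auto
  also have "sqrt (\<Sum>s\<in>S. (g i s)\<^sup>2) * sqrt \<dots> = (\<Prod>i\<in>I. sqrt (\<Sum>s\<in>S. (g i s)\<^sup>2))"
    using K by (simp add: sqrt_prod)
  finally show ?thesis by (simp add: mult_left_mono sum_nonneg)
qed

text \<open>Expanding the product of the \<open>1 + \<sigma> \<Prod>\<^sub>i eps j (w i)\<close> over the characters turns the
  sum into \<open>\<Sum>\<^sub>T \<sigma>\<^bsup>|T|\<^esup> \<Prod>\<^sub>i (f i)^(T)\<close>, which is bounded by Cauchy-Schwarz and Parseval.\<close>

lemma sum_parity_weight_prod: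
  fixes f :: "nat \<Rightarrow> nat set \<Rightarrow> real"
  assumes J: "finite J"
  shows "(\<Sum>w\<in>PiE {..<k} (\<lambda>_. Pow J). (\<Prod>j\<in>J. 1 + \<sigma> * (\<Prod>i<k. eps j (w i))) * (\<Prod>i<k. f i (w i))) =
    (\<Sum>T\<in>Pow J. \<sigma> ^ card T * (\<Prod>i<k. \<Sum>X\<in>Pow J. chi T X * f i X))"
proof -
  have exp: "(\<Prod>j\<in>J. 1 + \<sigma> * (\<Prod>i<k. eps j (w i))) = (\<Sum>T\<in>Pow J. \<sigma> ^ card T * (\<Prod>i<k. chi T (w i)))" for w
  proof -
    have "(\<Prod>j\<in>J. \<sigma> * (\<Prod>i<k. eps j (w i)) + 1) =
       (\<Sum>T\<in>Pow J. (\<Prod>j\<in>T. \<sigma> * (\<Prod>i<k. eps j (w i))))"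
      by (simp add: prod_add[OF J])
    also have "\<dots> = (\<Sum>T\<in>Pow J. \<sigma> ^ card T * (\<Prod>i<k. chi T (w i)))"
      unfolding chi_def by (intro sum.cong refl) (simp add: prod.distrib prod.swap[of _ "{..<k}"])
    finally show ?thesis by (simp add: add.commute)
  qed
  have "(\<Sum>w\<in>PiE {..<k} (\<lambda>_. Pow J). (\<Prod>j\<in>J. 1 + \<sigma> * (\<Prod>i<k. eps j (w i))) * (\<Prod>i<k. f i (w i))) =
    (\<Sum>w\<in>PiE {..<k} (\<lambda>_. Pow J). \<Sum>T\<in>Pow J. \<sigma> ^ card T * (\<Prod>i<k. chi T (w i) * f i (w i)))"
    by (simp add: exp sum_distrib_right prod.distrib mult.assoc)
  also have "\<dots> = (\<Sum>T\<in>Pow J. \<Sum>w\<in>PiE {..<k} (\<lambda>_. Pow J). \<sigma> ^ card T * (\<Prod>i<k. chi T (w i) * f i (w i)))"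
    by (rule sum.swap)
  also have "\<dots> = (\<Sum>T\<in>Pow J. \<sigma> ^ card T * (\<Prod>i<k. \<Sum>X\<in>Pow J. chi T X * f i X))"
    using J by (simp add: sum_distrib_left prod_sum_PiE)
  finally show ?thesis .
qed

lemma sum_parity_weight_prod_le:
  fixes f :: "nat \<Rightarrow> nat set \<Rightarrow> real"
  assumes J: "finite J" and k: "k \<ge> 2" and \<sigma>: "\<bar>\<sigma>\<bar> = 1"
  shows "(\<Sum>w\<in>PiE {..<k} (\<lambda>_. Pow J). (\<Prod>j\<in>J. 1 + \<sigma> * (\<Prod>i<k. eps j (w i))) * (\<Prod>i<k. f i (w i)))
    \<le> (\<Prod>i<k. sqrt (2 ^ card J * (\<Sum>X\<in>Pow J. (f i X)\<^sup>2)))"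
proof -
  define F where "F i T = (\<Sum>X\<in>Pow J. chi T X * f i X)" for i T
  have "(\<Sum>T\<in>Pow J. \<sigma> ^ card T * (\<Prod>i<k. F i T)) \<le> (\<Sum>T\<in>Pow J. \<Prod>i<k. \<bar>F i T\<bar>)"
  proof (rule sum_mono)
    fix T
    have "\<sigma> ^ card T * (\<Prod>i<k. F i T) \<le> \<bar>\<sigma> ^ card T * (\<Prod>i<k. F i T)\<bar>" by (rule abs_ge_self)
    then show "\<sigma> ^ card T * (\<Prod>i<k. F i T) \<le> (\<Prod>i<k. \<bar>F i T\<bar>)"
      by (simp add: abs_mult power_abs \<sigma> abs_prod)
  qed
  also have "\<dots> \<le> (\<Prod>i<k. sqrt (\<Sum>T\<in>Pow J. (F i T)\<^sup>2))"
    using J k by (intro sum_prod_le_L2) auto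
  finally show ?thesis
    unfolding sum_parity_weight_prod[OF J] F_def by (simp add: parseval[OF J])
qed

text \<open>Hence the weight is a density of mean one against uniform inputs. A nonempty
  \<open>T\<close> contributes \<open>0 ^ k\<close>, which vanishes because
  \<open>k \<ge> 1\<close>.\<close>

lemma sum_parity_weight:
  assumes J: "finite J" and k: "k \<ge> 1"
  shows "(\<Sum>w\<in>PiE {..<k} (\<lambda>_. Pow J). \<Prod>j\<in>J. 1 + \<sigma> * (\<Prod>i<k. eps j (w i))) = (2 ^ card J) ^ k"
proof -
  have "(\<Sum>w\<in>PiE {..<k} (\<lambda>_. Pow J). \<Prod>j\<in>J. 1 + \<sigma> * (\<Prod>i<k. eps j (w i))) =
    (\<Sum>T\<in>Pow J. \<sigma> ^ card T * (\<Prod>i<k. \<Sum>X\<in>Pow J. chi T X))"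
    using sum_parity_weight_prod[OF J, of \<sigma> k "\<lambda>_ _. 1"] by simp
  also have "\<dots> = (\<Sum>T\<in>Pow J. if T = {} then (2 ^ card J) ^ k else 0)"
    using J k by (intro sum.cong refl) (auto simp: sum_chi power_0_left)
  also have "\<dots> = (2 ^ card J) ^ k" using J by (simp add: sum.delta)
  finally show ?thesis .
qed

section \<open>Sub-Gaussian moments of signed sums\<close>

lemma power_le_fact_exp:
  fixes y :: real
  assumes "y \<ge> 0"
  shows "y ^ n \<le> fact n * exp y"
proof -
  have "(\<Sum>i\<in>{n}. y ^ i /\<^sub>R fact i) \<le> (\<Sum>i. y ^ i /\<^sub>R fact i)"
    using assms by (intro sum_le_suminf summable_exp_generic) auto
  then show ?thesis by (simp add: exp_def field_simps)
qed

text \<open>The two power series are compared term by term through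
  \<open>2 ^ n * fact n \<le> fact (2 * n)\<close>.\<close>

lemma cosh_le_exp_square: "cosh x \<le> exp (x\<^sup>2 / 2)" for x :: real
proof -
  have c: "(\<lambda>n. x ^ (2 * n) /\<^sub>R fact (2 * n)) sums cosh x"
  proof -
    have "(if even n then x ^ n /\<^sub>R fact n else 0) = 0" if "n \<notin> range ((*) 2)" for n :: nat
      using that by (auto elim!: evenE)
    then show ?thesis
      using cosh_converges[of x] sums_mono_reindex[of "\<lambda>n. 2 * n" "\<lambda>n. if even n then x ^ n /\<^sub>R fact n else 0" "cosh x"]
      by (auto simp: strict_mono_def)
  qed
  have e: "(\<lambda>n. (x\<^sup>2 / 2) ^ n /\<^sub>R fact n) sums exp (x\<^sup>2 / 2)"
    by (rule exp_converges)
  have "2 ^ n * fact n \<le> (fact (2 * n) :: real)" for n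
  proof (induction n)
    case (Suc n)
    have "2 ^ Suc n * fact (Suc n) = (2 * (real n + 1)) * (2 ^ n * fact n)"
      by simp
    also have "\<dots> \<le> (2 * real n + 2) * (2 * real n + 1) * fact (2 * n)"
      by (intro mult_mono order.trans[OF _ mult_left_mono[of 1 "2 * real n + 1" "2 * real n + 2"]] Suc) auto
    finally show ?case by (simp add: algebra_simps)
  qed simp
  note F = this
  have "x ^ (2 * n) /\<^sub>R fact (2 * n) \<le> (x\<^sup>2 / 2) ^ n /\<^sub>R fact n" for n
  proof -
    have "x ^ (2 * n) /\<^sub>R fact (2 * n) = (x\<^sup>2) ^ n / fact (2 * n)"
      by (subst power_mult[of x 2 n]) (simp add: divide_inverse)
    also have "\<dots> \<le> (x\<^sup>2) ^ n / (2 ^ n * fact n)"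
      by (intro divide_left_mono F) auto
    also have "\<dots> = (x\<^sup>2 / 2) ^ n /\<^sub>R fact n"
      by (simp add: power_divide field_simps)
    finally show ?thesis .
  qed
  then show ?thesis by (rule sums_le[OF _ c e])
qed

text \<open>The moment generating function factorises into hyperbolic cosines and is therefore
  Gaussian-bounded. An even power is dominated by the sum of the exponentials at \<open>s\<close>
  and \<open>- s\<close>; the scale \<open>s\<close> stays free and is optimised by the
  caller.\<close>

lemma rademacher_moment:
  fixes a :: "nat \<Rightarrow> real"
  assumes A: "finite A"  and s: "s > 0"
  shows "(\<Sum>X\<in>Pow A. (\<Sum>j\<in>A. a j * eps j X) ^ (2 * p)) * s ^ (2 * p)
     \<le> 2 ^ card A * (2 * fact (2 * p) * exp (s\<^sup>2 / 2 * (\<Sum>j\<in>A. (a j)\<^sup>2)))"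
proof -
  have mgf: "(\<Sum>X\<in>Pow A. exp (r * (\<Sum>j\<in>A. a j * eps j X))) \<le> 2 ^ card A * exp (r\<^sup>2 / 2 * (\<Sum>j\<in>A. (a j)\<^sup>2))" for r
  proof -
    have "(\<Sum>X\<in>Pow A. exp (r * (\<Sum>j\<in>A. a j * eps j X))) =
        (\<Sum>X\<in>Pow A. \<Prod>j\<in>A. if j \<in> X then exp (- (r * a j)) else exp (r * a j))"
      using A by (auto simp: sum_distrib_left exp_sum eps_def intro!: sum.cong prod.cong)
    also have "\<dots> = (\<Prod>j\<in>A. exp (- (r * a j)) + exp (r * a j))"
      by (rule sum_Pow_prod[OF A])
    also have "\<dots> = (\<Prod>j\<in>A. 2 * cosh (r * a j))"
      by (intro prod.cong refl) (simp add: cosh_field_def)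
    also have "\<dots> \<le> (\<Prod>j\<in>A. 2 * exp ((r * a j)\<^sup>2 / 2))"
      by (intro prod_mono conjI mult_left_mono cosh_le_exp_square) auto
    also have "\<dots> = 2 ^ card A * exp (r\<^sup>2 / 2 * (\<Sum>j\<in>A. (a j)\<^sup>2))"
      using A by (simp add: prod.distrib exp_sum sum_distrib_left power_mult_distrib)
    finally show ?thesis .
  qed
  have eq: "S ^ (2 * p) * s ^ (2 * p) = \<bar>s * S\<bar> ^ (2 * p)" for S
  proof -
    have "\<bar>s * S\<bar> ^ (2 * p) = (s * S) ^ (2 * p)" by (rule power_even_abs) simp
    also have "\<dots> = S ^ (2 * p) * s ^ (2 * p)"
      by (subst mult.commute) (rule power_mult_distrib)
    finally show ?thesis ..
  qed
  have "(\<Sum>X\<in>Pow A. (\<Sum>j\<in>A. a j * eps j X) ^ (2 * p)) * s ^ (2 * p) =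
     (\<Sum>X\<in>Pow A. \<bar>s * (\<Sum>j\<in>A. a j * eps j X)\<bar> ^ (2 * p))"
    unfolding sum_distrib_right by (rule sum.cong[OF refl], rule eq)
  also have "\<dots> \<le> (\<Sum>X\<in>Pow A. fact (2 * p) * (exp (s * (\<Sum>j\<in>A. a j * eps j X)) + exp (- s * (\<Sum>j\<in>A. a j * eps j X))))"
  proof (rule sum_mono)
    fix X
    define y where "y = s * (\<Sum>j\<in>A. a j * eps j X)"
    have "\<bar>y\<bar> ^ (2 * p) \<le> fact (2 * p) * exp \<bar>y\<bar>" by (rule power_le_fact_exp) simp
    also have "exp \<bar>y\<bar> \<le> exp y + exp (- y)" by (simp add: abs_if)
    finally show "\<bar>s * (\<Sum>j\<in>A. a j * eps j X)\<bar> ^ (2 * p) \<le>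
       fact (2 * p) * (exp (s * (\<Sum>j\<in>A. a j * eps j X)) + exp (- s * (\<Sum>j\<in>A. a j * eps j X)))"
      by (simp add: y_def mult_left_mono)
  qed
  also have "\<dots> = fact (2 * p) * ((\<Sum>X\<in>Pow A. exp (s * (\<Sum>j\<in>A. a j * eps j X))) + (\<Sum>X\<in>Pow A. exp (- s * (\<Sum>j\<in>A. a j * eps j X))))"
    by (simp only: sum_distrib_left[symmetric] sum.distrib)
  also have "\<dots> \<le> fact (2 * p) * (2 ^ card A * exp (s\<^sup>2 / 2 * (\<Sum>j\<in>A. (a j)\<^sup>2)) + 2 ^ card A * exp ((- s)\<^sup>2 / 2 * (\<Sum>j\<in>A. (a j)\<^sup>2)))"
    by (intro mult_left_mono add_mono mgf) auto
  finally show ?thesis by (simp add: mult_ac)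
qed

section \<open>Trace norm and matrix moments\<close>

text \<open>The trace norm, read off a chosen diagonalization. \<open>tnorm_obtain\<close> returns a
  diagonalization that realises the chosen value, and both the duality below and the bound for
  product measurements start from it.\<close>

definition tnorm :: "nat \<Rightarrow> (nat \<Rightarrow> nat \<Rightarrow> complex) \<Rightarrow> real" where
  "tnorm d M = (SOME \<tau>. \<exists>U \<mu>. diagonalizes d M U \<mu> \<and> \<tau> = (\<Sum>l<d. \<bar>\<mu> l\<bar>))"

lemma tnorm_obtain:
  assumes "hermitian_on d M"
  obtains U \<mu> where "diagonalizes d M U \<mu>" "tnorm d M = (\<Sum>l<d. \<bar>\<mu> l\<bar>)"
proof -
  have "\<exists>\<tau> U \<mu>. diagonalizes d M U \<mu> \<and> \<tau> = (\<Sum>l<d. \<bar>\<mu> l\<bar>)"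
    using hermitian_diagonalizable[OF assms] by metis
  from someI_ex[OF this] show thesis using that unfolding tnorm_def by blast
qed

lemma tnorm_nonneg: "hermitian_on d M \<Longrightarrow> 0 \<le> tnorm d M"
  by (metis tnorm_obtain sum_nonneg abs_ge_zero)

lemma hermitian_on_scaled_sum:
  assumes "\<And>s. s \<in> S \<Longrightarrow> hermitian_on d (F s)"
  shows "hermitian_on d (\<lambda>a b. \<Sum>s\<in>S. of_real (c s) * F s a b)"
  using assms by (auto simp: hermitian_on_def intro!: sum.cong)

lemma diagonalizes_hermitian: "diagonalizes d M U \<mu> \<Longrightarrow> hermitian_on d M"
  by (auto simp: hermitian_on_def diagonalizes_def mult_ac)

text \<open>Polarization: the quadratic form is real at the sums of the \<open>a\<close>-th unit
  vector and \<open>z\<close> times the \<open>b\<close>-th one. The values \<open>z = 1\<close> and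
  \<open>z = \<i>\<close> determine the imaginary and the real part of the difference between an
  entry and the conjugate of its mirror image.\<close>

lemma psd_on_hermitian:
  assumes psd: "psd_on {..<d} A"
  shows "hermitian_on d A"
  unfolding hermitian_on_def
proof (intro allI impI)
  fix a b assume ab: "a < d" "b < d"
  have q: "A a a + z * A a b + cnj z * A b a + cnj z * z * A b b \<in> \<real>" for z
  proof -
    define v where "v x = of_bool (x = a) + z * of_bool (x = b)" for x
    have inner: "(\<Sum>y<d. A x y * v y) = A x a + z * A x b" for x
    proof -
      have "(\<Sum>y<d. A x y * v y) = (\<Sum>y<d. A x y * of_bool (y = a)) + z * (\<Sum>y<d. A x y * of_bool (y = b))"
        by (simp only: v_def distrib_left sum.distrib sum_distrib_left mult.left_commute)
      then show ?thesis by (simp only: sum_kronecker(4)[OF ab(1)] sum_kronecker(4)[OF ab(2)])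
    qed
    have cv: "cnj (v x) = of_bool (x = a) + cnj z * of_bool (x = b)" for x
      by (simp add: v_def)
    have outer: "(\<Sum>x<d. cnj (v x) * f x) = f a + cnj z * f b" for f
    proof -
      have "(\<Sum>x<d. cnj (v x) * f x) = (\<Sum>x<d. of_bool (x = a) * f x) + cnj z * (\<Sum>x<d. of_bool (x = b) * f x)"
        by (simp only: cv distrib_right sum.distrib sum_distrib_left mult.assoc)
      then show ?thesis by (simp only: sum_kronecker(2)[OF ab(1)] sum_kronecker(2)[OF ab(2)])
    qed
    have "(\<Sum>x<d. \<Sum>y<d. cnj (v x) * A x y * v y) = (\<Sum>x<d. cnj (v x) * (\<Sum>y<d. A x y * v y))"
      by (simp add: sum_distrib_left mult.assoc)
    also have "\<dots> = (A a a + z * A a b) + cnj z * (A b a + z * A b b)"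
      unfolding inner outer ..
    finally have eq: "(\<Sum>x<d. \<Sum>y<d. cnj (v x) * A x y * v y) = (A a a + z * A a b) + cnj z * (A b a + z * A b b)" .
    have "(\<Sum>x<d. \<Sum>y<d. cnj (v x) * A x y * v y) \<in> \<real>" using psd unfolding psd_on_def by blast
    then show ?thesis unfolding eq by (simp add: algebra_simps)
  qed
  have q': "A b b \<in> \<real>"
  proof -
    have "A a a \<in> \<real>" if "a < d" for a
    proof -
      define v :: "nat \<Rightarrow> complex" where "v x = of_bool (x = a)" for x
      have cv: "cnj (v x) = of_bool (x = a)" for x by (simp add: v_def)
      have "(\<Sum>x<d. \<Sum>y<d. cnj (v x) * A x y * v y) = (\<Sum>x<d. of_bool (x = a) * (\<Sum>y<d. A x y * of_bool (y = a)))"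
        unfolding cv by (simp only: v_def sum_distrib_left mult.assoc)
      also have "\<dots> = A a a"
        by (simp only: sum_kronecker(4)[OF that] sum_kronecker(2)[OF that])
      finally have eq: "(\<Sum>x<d. \<Sum>y<d. cnj (v x) * A x y * v y) = A a a" .
      have "(\<Sum>x<d. \<Sum>y<d. cnj (v x) * A x y * v y) \<in> \<real>" using psd unfolding psd_on_def by blast
      then show ?thesis unfolding eq .
    qed
    then show ?thesis using ab by simp
  qed
  have "A a a \<in> \<real>" using q[of 0] by simp
  with q' q[of 1] q[of \<i>] show "cnj (A a b) = A b a"
    by (auto simp: complex_is_Real_iff complex_eq_iff)
qed

lemma density_hermitian: "Defs.density d \<rho> \<Longrightarrow> hermitian_on d \<rho>"
  by (simp add: Defs.density_def psd_on_hermitian)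

lemma trace_diagonal:
  assumes "diagonalizes d H U \<mu>"
  shows "(\<Sum>a<d. \<Sum>b<d. \<rho> a b * H b a) =
     (\<Sum>l<d. of_real (\<mu> l) * (\<Sum>a<d. \<Sum>b<d. cnj (U a l) * \<rho> a b * U b l))"
proof -
  have "(\<Sum>a<d. \<Sum>b<d. \<rho> a b * H b a) =
     (\<Sum>a<d. \<Sum>b<d. \<Sum>l<d. of_real (\<mu> l) * (cnj (U a l) * \<rho> a b * U b l))"
    using assms unfolding diagonalizes_def
    by (intro sum.cong refl) (simp add: sum_distrib_left mult_ac)
  also have "\<dots> = (\<Sum>a<d. \<Sum>l<d. \<Sum>b<d. of_real (\<mu> l) * (cnj (U a l) * \<rho> a b * U b l))"
    by (rule sum.cong[OF refl], rule sum.swap)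
  also have "\<dots> = (\<Sum>l<d. \<Sum>a<d. \<Sum>b<d. of_real (\<mu> l) * (cnj (U a l) * \<rho> a b * U b l))"
    by (rule sum.swap)
  finally show ?thesis by (simp add: sum_distrib_left)
qed

text \<open>The weights are the outcome probabilities of measuring the state in the eigenbasis of
  \<open>H\<close>. That they sum to one is the same trace formula applied to the identity, which
  \<open>U\<close> diagonalizes as well.\<close>

lemma density_expectation:
  assumes \<rho>: "Defs.density d \<rho>" and H: "diagonalizes d H U \<mu>"
  obtains w where "\<And>l. l < d \<Longrightarrow> 0 \<le> w l" "(\<Sum>l<d. w l) = 1"
    "(\<Sum>a<d. \<Sum>b<d. \<rho> a b * H b a) = complex_of_real (\<Sum>l<d. w l * \<mu> l)"
proof -
  define w where "w l = Re (\<Sum>a<d. \<Sum>b<d. cnj (U a l) * \<rho> a b * U b l)" for l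
  have w: "(\<Sum>a<d. \<Sum>b<d. cnj (U a l) * \<rho> a b * U b l) = of_real (w l)" "0 \<le> w l" for l
  proof -
    have "(\<Sum>a<d. \<Sum>b<d. cnj (U a l) * \<rho> a b * U b l) \<in> \<real> \<and> 0 \<le> w l"
      using \<rho> unfolding Defs.density_def psd_on_def w_def
      by (elim conjE allE[of _ "\<lambda>a. U a l"]) (intro conjI)
    then show "(\<Sum>a<d. \<Sum>b<d. cnj (U a l) * \<rho> a b * U b l) = of_real (w l)" "0 \<le> w l"
      unfolding w_def by (simp_all only: of_real_Re)
  qed
  have H1: "diagonalizes d (\<lambda>a b. of_bool (a = b)) U (\<lambda>_. 1)"
    using H by (simp add: diagonalizes_def unitary_on_def)
  have "complex_of_real (\<Sum>l<d. w l) = (\<Sum>a<d. \<Sum>b<d. \<rho> a b * of_bool (b = a))"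
    unfolding trace_diagonal[OF H1] w(1) by simp
  also have "\<dots> = (\<Sum>a<d. \<rho> a a)"
    by (intro sum.cong refl sum_kronecker) auto
  also have "\<dots> = 1" using \<rho> by (simp add: Defs.density_def)
  finally have "(\<Sum>l<d. w l) = 1" by (simp only: of_real_eq_1_iff)
  moreover have "(\<Sum>a<d. \<Sum>b<d. \<rho> a b * H b a) = complex_of_real (\<Sum>l<d. w l * \<mu> l)"
    unfolding trace_diagonal[OF H] w(1) by (simp add: mult.commute)
  ultimately show thesis using that w(2) by blast
qed

text \<open>The dual witness for the trace norm: every eigenvalue is replaced by its sign. Unitarity
  will make words in such matrices unitary, and eigenvalues of modulus one keep the expectation in
  any state within [-1,1].\<close>

lemma sign_matrix:
  assumes "hermitian_on d M"
  obtains A U s where "unitary_on d A" "diagonalizes d A U s" "\<And>l. \<bar>s l\<bar> = 1"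
    "(\<Sum>a<d. \<Sum>b<d. M a b * A b a) = complex_of_real (tnorm d M)"
proof -
  obtain U \<mu> where M: "diagonalizes d M U \<mu>" "tnorm d M = (\<Sum>l<d. \<bar>\<mu> l\<bar>)"
    using tnorm_obtain[OF assms] by blast
  have U: "unitary_on d U" using M(1) by (simp add: diagonalizes_def)
  \<comment> \<open>A zero eigenvalue gets sign 1; with sign 0 the matrix would not be
    unitary.\<close>
  define s where "s l = (if \<mu> l \<ge> 0 then 1 else -1 :: real)" for l
  define V where "V a l = U a l * of_real (s l)" for a l
  define W where "W l b = cnj (U b l)" for l b
  define A where "A = mmul d V W"
  have ss: "complex_of_real (s l) * of_real (s l) = 1" for l by (simp add: s_def)
  have "unitary_on d V"
    unfolding unitary_on_def
  proof (intro conjI allI impI)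
    fix l l' assume "l < d" "l' < d"
    moreover have "(\<Sum>a<d. cnj (V a l) * V a l') = of_real (s l) * of_real (s l') * (\<Sum>a<d. cnj (U a l) * U a l')"
      by (simp add: V_def sum_distrib_left mult_ac)
    ultimately show "(\<Sum>a<d. cnj (V a l) * V a l') = of_bool (l = l')"
      using U ss[of l] by (auto simp: unitary_on_def)
  next
    fix a b assume "a < d" "b < d"
    moreover have "V a l * cnj (V b l) = U a l * cnj (U b l)" for l
      using ss[of l] by (simp add: V_def mult_ac)
    ultimately show "(\<Sum>l<d. V a l * cnj (V b l)) = of_bool (a = b)"
      using U by (simp add: unitary_on_def)
  qed
  moreover have "unitary_on d W"
    using U by (auto simp: unitary_on_def W_def mult.commute)
  ultimately have A: "unitary_on d A" unfolding A_def by (rule unitary_on_mmul)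
  have dA: "diagonalizes d A U s"
    unfolding diagonalizes_def using U by (simp add: A_def mmul_def V_def W_def mult_ac)
  have Mq: "(\<Sum>a<d. \<Sum>b<d. cnj (U a l) * M a b * U b l) = of_real (\<mu> l)" if l: "l < d" for l
  proof -
    have "(\<Sum>a<d. \<Sum>b<d. cnj (U a l) * M a b * U b l) =
       (\<Sum>a<d. cnj (U a l) * (\<Sum>b<d. \<Sum>l'<d. of_real (\<mu> l') * U a l' * (cnj (U b l') * U b l)))"
      using M(1) unfolding diagonalizes_def
      by (intro sum.cong refl) (simp add: sum_distrib_left sum_distrib_right mult_ac)
    also have "\<dots> = (\<Sum>a<d. cnj (U a l) * (\<Sum>l'<d. of_real (\<mu> l') * U a l' * (\<Sum>b<d. cnj (U b l') * U b l)))"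
      by (rule sum.cong[OF refl], subst sum.swap, simp add: sum_distrib_left)
    also have "\<dots> = (\<Sum>a<d. cnj (U a l) * (\<Sum>l'<d. of_real (\<mu> l') * U a l' * of_bool (l' = l)))"
      using U l by (intro sum.cong refl arg_cong2[where f="(*)"]) (simp add: unitary_on_def)
    also have "\<dots> = (\<Sum>a<d. of_real (\<mu> l) * (cnj (U a l) * U a l))"
      by (simp only: sum_kronecker(4)[OF l]) (simp add: mult_ac)
    also have "\<dots> = of_real (\<mu> l)"
      using U l by (simp add: unitary_on_def flip: sum_distrib_left)
    finally show ?thesis .
  qed
  have "(\<Sum>a<d. \<Sum>b<d. M a b * A b a) = (\<Sum>l<d. of_real (s l) * of_real (\<mu> l))"
    unfolding trace_diagonal[OF dA] by (simp add: Mq)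
  also have "\<dots> = complex_of_real (tnorm d M)"
    unfolding M(2) of_real_sum by (intro sum.cong refl) (simp add: s_def)
  finally show thesis using that[OF A dA] by (simp add: s_def)
qed

section \<open>Matrix powers, words and their traces\<close>

fun mpow :: "nat \<Rightarrow> (nat \<Rightarrow> nat \<Rightarrow> complex) \<Rightarrow> nat \<Rightarrow> nat \<Rightarrow> nat \<Rightarrow> complex" where
  "mpow d A 0 = (\<lambda>a b. of_bool (a = b))"
| "mpow d A (Suc n) = mmul d A (mpow d A n)"

lemma diagonalizes_mpow:
  assumes "diagonalizes d H U \<mu>"
  shows "diagonalizes d (mpow d H n) U (\<lambda>l. \<mu> l ^ n)"
proof -
  have U: "unitary_on d U" using assms by (simp add: diagonalizes_def)
  have "mpow d H n a b = (\<Sum>l<d. of_real (\<mu> l ^ n) * U a l * cnj (U b l))" if "a < d" "b < d" for a b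
    using that
  proof (induction n arbitrary: a b)
    case 0
    then show ?case using U by (simp add: unitary_on_def)
  next
    case (Suc n)
    have "mpow d H (Suc n) a b = (\<Sum>c<d. (\<Sum>l<d. of_real (\<mu> l) * U a l * cnj (U c l)) *
        (\<Sum>l<d. of_real (\<mu> l ^ n) * U c l * cnj (U b l)))"
      using assms Suc by (simp add: mmul_def diagonalizes_def)
    also have "\<dots> = (\<Sum>c<d. \<Sum>l<d. \<Sum>l'<d. (of_real (\<mu> l) * U a l * of_real (\<mu> l' ^ n) * cnj (U b l')) * (cnj (U c l) * U c l'))"
      by (simp add: sum_product mult_ac)
    also have "\<dots> = (\<Sum>l<d. \<Sum>c<d. \<Sum>l'<d. (of_real (\<mu> l) * U a l * of_real (\<mu> l' ^ n) * cnj (U b l')) * (cnj (U c l) * U c l'))"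
      by (rule sum.swap)
    also have "\<dots> = (\<Sum>l<d. \<Sum>l'<d. (of_real (\<mu> l) * U a l * of_real (\<mu> l' ^ n) * cnj (U b l')) * (\<Sum>c<d. cnj (U c l) * U c l'))"
      by (rule sum.cong[OF refl], subst sum.swap, simp only: sum_distrib_left)
    also have "\<dots> = (\<Sum>l<d. \<Sum>l'<d. (of_real (\<mu> l) * U a l * of_real (\<mu> l' ^ n) * cnj (U b l')) * of_bool (l = l'))"
      using U by (intro sum.cong refl arg_cong2[where f="(*)"]) (simp add: unitary_on_def)
    also have "\<dots> = (\<Sum>l<d. of_real (\<mu> l) * U a l * of_real (\<mu> l ^ n) * cnj (U b l))"
      by (intro sum.cong refl sum_kronecker) auto
    finally show ?case by (simp add: mult_ac)
  qed
  then show ?thesis using U by (simp add: diagonalizes_def)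
qed

text \<open>The expectation is an average of eigenvalues, so Jensen applies to the even power, and
  weights at most one bound the result by the full sum of eigenvalue powers. This removes the state
  in favour of a trace, on which averages of words can be computed.\<close>

lemma density_moment_le_trace:
  assumes \<rho>: "Defs.density d \<rho>" and H: "hermitian_on d H" and R: "even R"
  shows "(Re (\<Sum>a<d. \<Sum>b<d. \<rho> a b * H b a)) ^ R \<le> Re (\<Sum>a<d. mpow d H R a a)"
proof -
  obtain U \<mu> where D: "diagonalizes d H U \<mu>" using hermitian_diagonalizable[OF H] by blast
  have U: "unitary_on d U" using D by (simp add: diagonalizes_def)
  obtain w where w: "\<And>l. l < d \<Longrightarrow> 0 \<le> w l" "(\<Sum>l<d. w l) = 1"
    "(\<Sum>a<d. \<Sum>b<d. \<rho> a b * H b a) = complex_of_real (\<Sum>l<d. w l * \<mu> l)"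
    using density_expectation[OF \<rho> D] by blast
  have ne: "{..<d} \<noteq> {}" using w(2) by auto
  have "(\<Sum>l<d. w l * \<mu> l) ^ R \<le> (\<Sum>l<d. w l * \<mu> l ^ R)"
    using convex_on_sum[OF finite_lessThan ne convex_power_even[OF R] w(2), of \<mu>] w(1) by simp
  also have "\<dots> \<le> (\<Sum>l<d. 1 * \<mu> l ^ R)"
  proof (intro sum_mono mult_right_mono)
    fix l assume "l \<in> {..<d}"
    then show "w l \<le> 1" using w(1) member_le_sum[of l "{..<d}" w] w(2) by auto
  qed (use R in \<open>simp add: zero_le_even_power\<close>)
  also have "complex_of_real (\<Sum>l<d. 1 * \<mu> l ^ R) = (\<Sum>a<d. mpow d H R a a)"
  proof -
    have "(\<Sum>a<d. mpow d H R a a) = (\<Sum>a<d. \<Sum>l<d. of_real (\<mu> l ^ R) * (cnj (U a l) * U a l))"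
      using diagonalizes_mpow[OF D, of R] by (simp add: diagonalizes_def mult_ac)
    also have "\<dots> = (\<Sum>l<d. of_real (\<mu> l ^ R) * (\<Sum>a<d. cnj (U a l) * U a l))"
      by (subst sum.swap) (simp only: sum_distrib_left)
    also have "\<dots> = of_real (\<Sum>l<d. 1 * \<mu> l ^ R)"
      using U by (simp add: unitary_on_def)
    finally show ?thesis ..
  qed
  then have "(\<Sum>l<d. 1 * \<mu> l ^ R) = Re (\<Sum>a<d. mpow d H R a a)"
    by (metis Re_complex_of_real)
  finally show ?thesis unfolding w(3) by simp
qed

definition words :: "nat set \<Rightarrow> nat \<Rightarrow> nat list set" where
  "words J n = {w. set w \<subseteq> J \<and> length w = n}"

fun wprod :: "nat \<Rightarrow> (nat \<Rightarrow> nat \<Rightarrow> nat \<Rightarrow> complex) \<Rightarrow> nat list \<Rightarrow> nat \<Rightarrow> nat \<Rightarrow> complex" where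
  "wprod d A [] = (\<lambda>a b. of_bool (a = b))"
| "wprod d A (j # w) = mmul d (A j) (wprod d A w)"

lemma words_0 [simp]: "words J 0 = {[]}"
  by (auto simp: words_def)

lemma sum_words_Suc:
  "(\<Sum>w\<in>words J (Suc n). f w) = (\<Sum>j\<in>J. \<Sum>w\<in>words J n. f (j # w))"
proof -
  have "words J (Suc n) = (\<lambda>(w, j). j # w) ` (words J n \<times> J)"
    unfolding words_def by (rule lists_length_Suc_eq)
  moreover have "inj_on (\<lambda>(w, j). j # w) (words J n \<times> J)" by (auto simp: inj_on_def)
  ultimately have "(\<Sum>w\<in>words J (Suc n). f w) = (\<Sum>(w, j)\<in>words J n \<times> J. f (j # w))"
    by (simp add: sum.reindex case_prod_unfold)
  also have "\<dots> = (\<Sum>w\<in>words J n. \<Sum>j\<in>J. f (j # w))" by (rule sum.cartesian_product[symmetric])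
  also have "\<dots> = (\<Sum>j\<in>J. \<Sum>w\<in>words J n. f (j # w))" by (rule sum.swap)
  finally show ?thesis .
qed

lemma mpow_words:
  "mpow d (\<lambda>a b. \<Sum>j\<in>J. of_real (c j) * A j a b) n a b =
     (\<Sum>w\<in>words J n. of_real (prod_list (map c w)) * wprod d A w a b)"
proof (induction n arbitrary: a b)
  case (Suc n)
  have "mpow d (\<lambda>a b. \<Sum>j\<in>J. of_real (c j) * A j a b) (Suc n) a b =
     (\<Sum>e<d. \<Sum>j\<in>J. \<Sum>w\<in>words J n. of_real (c j * prod_list (map c w)) * (A j a e * wprod d A w e b))"
    by (simp add: mmul_def Suc sum_product mult_ac)
  also have "\<dots> = (\<Sum>j\<in>J. \<Sum>e<d. \<Sum>w\<in>words J n. of_real (c j * prod_list (map c w)) * (A j a e * wprod d A w e b))"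
    by (rule sum.swap)
  also have "\<dots> = (\<Sum>j\<in>J. \<Sum>w\<in>words J n. \<Sum>e<d. of_real (c j * prod_list (map c w)) * (A j a e * wprod d A w e b))"
    by (rule sum.cong[OF refl], rule sum.swap)
  finally show ?case unfolding sum_words_Suc by (simp add: mmul_def sum_distrib_left)
qed simp

lemma power_sum_words:
  fixes c :: "nat \<Rightarrow> real"
  shows "(\<Sum>j\<in>J. c j) ^ n = (\<Sum>w\<in>words J n. prod_list (map c w))"
  by (induction n) (simp_all add: sum_words_Suc sum_product)

lemma wprod_unitary:
  assumes "\<And>j. j \<in> set w \<Longrightarrow> unitary_on d (A j)"
  shows "unitary_on d (wprod d A w)"
  using assms
  by (induction w) (auto simp: unitary_on_mmul unitary_on_def[of d "\<lambda>a b. of_bool (a = b)"] sum_kronecker)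

text \<open>Columns have norm one, so every diagonal entry has modulus at most one.\<close>

lemma unitary_trace_le:
  assumes "unitary_on d U"
  shows "Re (\<Sum>a<d. U a a) \<le> real d"
proof -
  have "Re (U a a) \<le> 1" if "a < d" for a
  proof -
    have "complex_of_real (\<Sum>c<d. (cmod (U c a))\<^sup>2) = (\<Sum>c<d. cnj (U c a) * U c a)"
      by (simp add: complex_norm_square mult.commute del: of_real_power)
    then have "complex_of_real (\<Sum>c<d. (cmod (U c a))\<^sup>2) = 1" using assms that by (simp add: unitary_on_def)
    then have "(\<Sum>c<d. (cmod (U c a))\<^sup>2) = 1" by (simp only: of_real_eq_1_iff)
    then have "(cmod (U a a))\<^sup>2 \<le> 1"
      using member_le_sum[of a "{..<d}" "\<lambda>c. (cmod (U c a))\<^sup>2"] that by simp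
    then have "cmod (U a a) \<le> 1" by (simp add: power_le_one_iff)
    then show ?thesis using complex_Re_le_cmod order.trans by blast
  qed
  then have "Re (\<Sum>a<d. U a a) \<le> (\<Sum>a<d. 1)" unfolding Re_sum by (intro sum_mono) auto
  then show ?thesis by simp
qed

text \<open>Equal letters cancel in pairs because signs square to one; \<open>T\<close> collects the
  letters of odd multiplicity.\<close>

lemma prod_list_eps_eq_chi:
  assumes "set w \<subseteq> A"
  shows "\<exists>T\<subseteq>A. finite T \<and> (\<forall>X. prod_list (map (\<lambda>j. eps j X) w) = chi T X)"
  using assms
proof (induction w)
  case Nil
  then show ?case by (intro exI[of _ "{}"]) (simp add: chi_def)
next
  case (Cons j w)
  then obtain T where T: "T \<subseteq> A" "finite T" "\<And>X. prod_list (map (\<lambda>j. eps j X) w) = chi T X"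
    by auto
  show ?case
  proof (cases "j \<in> T")
    case True
    have "eps j X * chi T X = chi (T - {j}) X" for X
      unfolding chi_def prod.remove[OF T(2) True] by (simp flip: mult.assoc)
    then show ?thesis using T by (intro exI[of _ "T - {j}"]) auto
  next
    case False
    then have "eps j X * chi T X = chi (insert j T) X" for X
      using T by (simp add: chi_def)
    then show ?thesis using T Cons.prems by (intro exI[of _ "insert j T"]) auto
  qed
qed

lemma sum_prod_list_eps_nonneg:
  assumes "finite A" "set w \<subseteq> A"
  shows "0 \<le> (\<Sum>X\<in>Pow A. prod_list (map (\<lambda>j. eps j X) w))"
proof -
  obtain T where T: "T \<subseteq> A" "\<And>X. prod_list (map (\<lambda>j. eps j X) w) = chi T X"
    using prod_list_eps_eq_chi[OF assms(2)] by metis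
  show ?thesis unfolding T(2) sum_chi[OF assms(1) T(1)] by simp
qed

text \<open>The trace of a word in unitary matrices is at most \<open>d\<close>, and the Rademacher averages of
  the words have nonnegative coefficients, so the scalar moments dominate the matrix ones.\<close>

lemma trace_moment_le:
  fixes c :: "nat \<Rightarrow> real"
  assumes A: "finite A" and U: "\<And>j. j \<in> A \<Longrightarrow> unitary_on d (V j)" and c: "\<And>j. j \<in> A \<Longrightarrow> 0 \<le> c j"
  shows "(\<Sum>X\<in>Pow A. Re (\<Sum>a<d. mpow d (\<lambda>a b. \<Sum>j\<in>A. of_real (c j * eps j X) * V j a b) R a a))
    \<le> real d * (\<Sum>X\<in>Pow A. (\<Sum>j\<in>A. c j * eps j X) ^ R)"
proof -
  have split: "prod_list (map (\<lambda>j. c j * eps j X) w) = prod_list (map c w) * prod_list (map (\<lambda>j. eps j X) w)" for X w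
    by (induction w) auto
  define E where "E w = prod_list (map c w) * (\<Sum>X\<in>Pow A. prod_list (map (\<lambda>j. eps j X) w))" for w
  have E: "0 \<le> E w" if "w \<in> words A R" for w
    using that A c unfolding E_def words_def
    by (intro mult_nonneg_nonneg prod_list_nonneg sum_prod_list_eps_nonneg) auto
  have "(\<Sum>X\<in>Pow A. Re (\<Sum>a<d. mpow d (\<lambda>a b. \<Sum>j\<in>A. of_real (c j * eps j X) * V j a b) R a a)) =
     (\<Sum>X\<in>Pow A. \<Sum>a<d. \<Sum>w\<in>words A R. prod_list (map (\<lambda>j. c j * eps j X) w) * Re (wprod d V w a a))"
    unfolding mpow_words by simp
  also have "\<dots> = (\<Sum>X\<in>Pow A. \<Sum>w\<in>words A R. prod_list (map (\<lambda>j. c j * eps j X) w) * Re (\<Sum>a<d. wprod d V w a a))"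
    by (rule sum.cong[OF refl], subst sum.swap) (simp add: sum_distrib_left)
  also have "\<dots> = (\<Sum>w\<in>words A R. E w * Re (\<Sum>a<d. wprod d V w a a))"
    by (subst sum.swap) (simp only: E_def split sum_distrib_left sum_distrib_right)
  also have "\<dots> \<le> (\<Sum>w\<in>words A R. E w * real d)"
    using U by (intro sum_mono mult_left_mono unitary_trace_le wprod_unitary E) (auto simp: words_def)
  also have "\<dots> = real d * (\<Sum>w\<in>words A R. \<Sum>X\<in>Pow A. prod_list (map (\<lambda>j. c j * eps j X) w))"
    by (simp add: E_def split sum_distrib_left sum_distrib_right mult_ac)
  also have "(\<Sum>w\<in>words A R. \<Sum>X\<in>Pow A. prod_list (map (\<lambda>j. c j * eps j X) w)) =
      (\<Sum>X\<in>Pow A. \<Sum>w\<in>words A R. prod_list (map (\<lambda>j. c j * eps j X) w))"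
    by (rule sum.swap)
  also have "\<dots> = (\<Sum>X\<in>Pow A. (\<Sum>j\<in>A. c j * eps j X) ^ R)"
    by (simp only: power_sum_words)
  finally show ?thesis .
qed

section \<open>Finner's inequality\<close>

lemma integrable_pmf_unit:
  fixes h :: "'a \<Rightarrow> real"
  assumes "\<And>x. 0 \<le> h x" "\<And>x. h x \<le> 1"
  shows "integrable (measure_pmf p) h"
  by (rule measure_pmf.integrable_const_bound[of _ 1]) (use assms in auto)

lemma expectation_unit:
  fixes h :: "'a \<Rightarrow> real"
  assumes "\<And>x. 0 \<le> h x" "\<And>x. h x \<le> 1"
  shows "0 \<le> measure_pmf.expectation p h" "measure_pmf.expectation p h \<le> 1"
proof -
  show "0 \<le> measure_pmf.expectation p h" by (rule Bochner_Integration.integral_nonneg) (use assms in auto)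
  have "measure_pmf.expectation p h \<le> measure_pmf.expectation p (\<lambda>_. 1)"
    by (intro Bochner_Integration.integral_mono integrable_pmf_unit) (use assms in auto)
  then show "measure_pmf.expectation p h \<le> 1" by simp
qed

lemma expectation_pair_pmf:
  fixes h :: "'a \<times> 'b \<Rightarrow> real"
  assumes "\<And>x. 0 \<le> h x" "\<And>x. h x \<le> 1"
  shows "measure_pmf.expectation (pair_pmf p q) h =
    measure_pmf.expectation p (\<lambda>a. measure_pmf.expectation q (\<lambda>b. h (a, b)))"
proof -
  have "ennreal (measure_pmf.expectation (pair_pmf p q) h) = (\<integral>\<^sup>+x. ennreal (h x) \<partial>pair_pmf p q)"
    by (rule nn_integral_eq_integral[symmetric]) (use assms in \<open>auto intro!: integrable_pmf_unit\<close>)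
  also have "\<dots> = (\<integral>\<^sup>+a. \<integral>\<^sup>+b. ennreal (h (a, b)) \<partial>q \<partial>p)"
    by (rule nn_integral_pair_pmf')
  also have "\<dots> = (\<integral>\<^sup>+a. ennreal (measure_pmf.expectation q (\<lambda>b. h (a, b))) \<partial>p)"
    by (intro nn_integral_cong nn_integral_eq_integral) (use assms in \<open>auto intro!: integrable_pmf_unit\<close>)
  also have "\<dots> = ennreal (measure_pmf.expectation p (\<lambda>a. measure_pmf.expectation q (\<lambda>b. h (a, b))))"
    by (rule nn_integral_eq_integral) (use assms in \<open>auto intro!: integrable_pmf_unit expectation_unit\<close>)
  finally show ?thesis
    using assms by (subst (asm) ennreal_inj) (auto intro!: expectation_unit)
qed

lemma expectation_Pi_pmf_insert:
  fixes h :: "('a \<Rightarrow> 'b) \<Rightarrow> real"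
  assumes "finite A" "x \<notin> A" "\<And>r. 0 \<le> h r" "\<And>r. h r \<le> 1"
  shows "measure_pmf.expectation (Pi_pmf (insert x A) dflt p) h =
    measure_pmf.expectation (Pi_pmf A dflt p) (\<lambda>r. measure_pmf.expectation (p x) (\<lambda>y. h (r(x := y))))"
proof -
  have "measure_pmf.expectation (Pi_pmf (insert x A) dflt p) h =
     measure_pmf.expectation (pair_pmf (Pi_pmf A dflt p) (p x)) (\<lambda>z. h ((fst z)(x := snd z)))"
    by (subst Pi_pmf_insert[OF assms(1,2)], subst pair_commute_pmf) (simp add: case_prod_unfold)
  also have "\<dots> = measure_pmf.expectation (Pi_pmf A dflt p) (\<lambda>r. measure_pmf.expectation (p x) (\<lambda>y. h (r(x := y))))"
    by (subst expectation_pair_pmf) (use assms in auto)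
  finally show ?thesis .
qed

text \<open>The arithmetic-geometric mean inequality for the \<open>t\<close>-th powers: a Young
  inequality with \<open>t\<close> equal exponents.\<close>

lemma prod_le_sum_power_div:
  fixes x :: "'i \<Rightarrow> real"
  assumes "finite I" "card I = t" "t > 0" "\<And>i. i \<in> I \<Longrightarrow> 0 \<le> x i"
  shows "(\<Prod>i\<in>I. x i) \<le> (\<Sum>i\<in>I. x i ^ t / real t)"
proof -
  have "(\<Prod>i\<in>I. x i ^ t) powr (1 / card I) \<le> (\<Sum>i\<in>I. x i ^ t / real (card I))"
    using assms by (intro arith_geom_mean) auto
  moreover have "(\<Prod>i\<in>I. x i ^ t) powr (1 / card I) = (\<Prod>i\<in>I. x i)"
  proof -
    define q where "q = (\<Prod>i\<in>I. x i)"
    have q: "0 \<le> q" unfolding q_def using assms by (intro prod_nonneg) auto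
    have "(q ^ t) powr (1 / t) = q"
    proof (cases "q = 0")
      case False
      then show ?thesis using q \<open>t > 0\<close> by (simp add: powr_realpow[symmetric] powr_powr)
    qed (use \<open>t > 0\<close> in \<open>simp add: zero_power\<close>)
    then show ?thesis unfolding q_def by (simp add: prod_power_distrib assms(2))
  qed
  ultimately show ?thesis using assms by simp
qed

lemma prod_unit:
  fixes f :: "'i \<Rightarrow> real"
  assumes "\<And>i. i \<in> I \<Longrightarrow> 0 \<le> f i \<and> f i \<le> 1"
  shows "0 \<le> (\<Prod>i\<in>I. f i)" "(\<Prod>i\<in>I. f i) \<le> 1"
  using assms by (auto intro: prod_nonneg prod_le_1)

text \<open>After division by the \<open>L^t\<close> norms, the pointwise Young inequality
  integrates to \<open>t\<close> summands \<open>1/t\<close>. If some norm is 0, its function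
  vanishes almost surely and so does the product.\<close>

lemma holder_pmf:
  fixes f :: "'i \<Rightarrow> 'a \<Rightarrow> real"
  assumes I: "finite I" "card I = t" "t > 0"
    and f: "\<And>i x. i \<in> I \<Longrightarrow> 0 \<le> f i x \<and> f i x \<le> 1"
  shows "measure_pmf.expectation p (\<lambda>x. \<Prod>i\<in>I. f i x) \<le>
    (\<Prod>i\<in>I. root t (measure_pmf.expectation p (\<lambda>x. f i x ^ t)))"
proof -
  define N where "N i = root t (measure_pmf.expectation p (\<lambda>x. f i x ^ t))" for i
  have ft: "0 \<le> f i x ^ t" "f i x ^ t \<le> 1" if "i \<in> I" for i x
    using f[OF that] by (auto simp: power_le_one)
  have Nt: "N i ^ t = measure_pmf.expectation p (\<lambda>x. f i x ^ t)" and N0: "0 \<le> N i" if "i \<in> I" for i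
  proof -
    have "0 \<le> measure_pmf.expectation p (\<lambda>x. f i x ^ t)"
      by (rule expectation_unit(1)) (use ft[OF that] in auto)
    then show "N i ^ t = measure_pmf.expectation p (\<lambda>x. f i x ^ t)" "0 \<le> N i"
      using I by (simp_all add: N_def real_root_pow_pos2)
  qed
  show ?thesis
  proof (cases "\<exists>i\<in>I. N i = 0")
    case True
    then obtain i where i: "i \<in> I" "N i = 0" by blast
    then have "measure_pmf.expectation p (\<lambda>x. f i x ^ t) = 0" using Nt[OF i(1)] I by (simp add: zero_power)
    then have "AE x in measure_pmf p. f i x ^ t = 0"
      using i ft by (subst (asm) integral_nonneg_eq_0_iff_AE) (auto intro!: integrable_pmf_unit)
    then have "AE x in measure_pmf p. (\<Prod>i\<in>I. f i x) = 0"
      by eventually_elim (use i I in auto)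
    then have "measure_pmf.expectation p (\<lambda>x. \<Prod>i\<in>I. f i x) = 0"
      by (simp add: integral_eq_zero_AE)
    then show ?thesis using N0 by (simp add: prod_nonneg flip: N_def)
  next
    case False
    then have N: "0 < N i" if "i \<in> I" for i using N0[OF that] that by (metis less_eq_real_def)
    have P: "0 < (\<Prod>i\<in>I. N i)" using N by (intro prod_pos) auto
    have eq: "measure_pmf.expectation p (\<lambda>x. \<Prod>i\<in>I. f i x) =
       (\<Prod>i\<in>I. N i) * measure_pmf.expectation p (\<lambda>x. \<Prod>i\<in>I. f i x / N i)"
      using P by (simp add: prod_dividef)
    have "measure_pmf.expectation p (\<lambda>x. \<Prod>i\<in>I. f i x / N i) \<le>
       measure_pmf.expectation p (\<lambda>x. \<Sum>i\<in>I. f i x ^ t / (N i ^ t * real t))"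
    proof (rule Bochner_Integration.integral_mono)
      show "integrable (measure_pmf p) (\<lambda>x. \<Prod>i\<in>I. f i x / N i)"
        unfolding prod_dividef using f
        by (intro integrable_divide_zero integrable_pmf_unit prod_unit) auto
      show "integrable (measure_pmf p) (\<lambda>x. \<Sum>i\<in>I. f i x ^ t / (N i ^ t * real t))"
        using ft by (intro Bochner_Integration.integrable_sum integrable_divide_zero integrable_pmf_unit) auto
      show "(\<Prod>i\<in>I. f i x / N i) \<le> (\<Sum>i\<in>I. f i x ^ t / (N i ^ t * real t))" for x
        using prod_le_sum_power_div[OF I, of "\<lambda>i. f i x / N i"] f N
        by (simp add: power_divide less_imp_le)
    qed
    also have "\<dots> = (\<Sum>i\<in>I. measure_pmf.expectation p (\<lambda>x. f i x ^ t) / (N i ^ t * real t))"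
      using ft by (subst Bochner_Integration.integral_sum) (auto intro!: integrable_divide_zero integrable_pmf_unit)
    also have "\<dots> = (\<Sum>i\<in>I. 1 / real t)"
      using N by (intro sum.cong refl) (simp add: Nt[symmetric] less_imp_neq[symmetric])
    also have "\<dots> = 1" using I by simp
    finally have "(\<Prod>i\<in>I. N i) * measure_pmf.expectation p (\<lambda>x. \<Prod>i\<in>I. f i x / N i) \<le> (\<Prod>i\<in>I. N i) * 1"
      using P by (intro mult_left_mono) auto
    then show ?thesis unfolding eq N_def[symmetric] by simp
  qed
qed

text \<open>Finner's inequality, by integrating out one shared string at a time with Hoelder's
  inequality for the \<open>t\<close> functions that see it.\<close>

lemma finner_pmf:
  fixes f :: "'i \<Rightarrow> ('i set \<Rightarrow> 'b) \<Rightarrow> real"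
  assumes "finite Sh" "finite I" "t > 0" "\<And>S. S \<in> Sh \<Longrightarrow> S \<subseteq> I \<and> card S = t"
    and "\<And>i r. i \<in> I \<Longrightarrow> 0 \<le> f i r \<and> f i r \<le> 1"
    and "\<And>i r r'. i \<in> I \<Longrightarrow> (\<And>S. S \<in> Sh \<Longrightarrow> i \<in> S \<Longrightarrow> r S = r' S) \<Longrightarrow> f i r = f i r'"
  shows "measure_pmf.expectation (Pi_pmf Sh dflt P) (\<lambda>r. \<Prod>i\<in>I. f i r) \<le>
    (\<Prod>i\<in>I. root t (measure_pmf.expectation (Pi_pmf Sh dflt P) (\<lambda>r. f i r ^ t)))"
  using assms
proof (induction Sh arbitrary: f rule: finite_induct)
  case empty
  have "root t (f i r ^ t) = f i r" if "i \<in> I" for i r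
    using empty.prems(2) empty.prems(4)[OF that, of r] by (intro real_root_power_cancel) auto
  then show ?case by simp
next
  case (insert S Sh)
  have S: "S \<subseteq> I" "card S = t" using insert.prems(3) by auto
  then have finS: "finite S" using insert.prems(1) finite_subset by blast
  have f01: "0 \<le> f i r" "f i r \<le> 1" if "i \<in> I" for i r
    using insert.prems(4)[OF that, of r] by auto
  have ft: "0 \<le> f i r ^ t" "f i r ^ t \<le> 1" if "i \<in> I" for i r
    using f01[OF that, of r] by (auto simp: power_le_one)
  \<comment> \<open>The players in \<open>S\<close> replace dependence on the string of
    \<open>S\<close> by their \<open>L^t\<close> norm over it; the others never see that
    string.\<close>
  define g where "g i r = (if i \<in> S then root t (measure_pmf.expectation (P S) (\<lambda>y. f i (r(S := y)) ^ t)) else f i r)" for i r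
  have drop: "f i (r(S := y)) = f i r" if "i \<in> I" "i \<notin> S" for i r y
    by (rule insert.prems(5)[OF that(1)]) (use that in auto)
  have E01: "0 \<le> measure_pmf.expectation (P S) (\<lambda>y. f i (r(S := y)) ^ t)"
    "measure_pmf.expectation (P S) (\<lambda>y. f i (r(S := y)) ^ t) \<le> 1" if "i \<in> I" for i r
    by (rule expectation_unit; rule ft[OF that])+
  have g01: "0 \<le> g i r \<and> g i r \<le> 1" if "i \<in> I" for i r
    using f01[OF that, of r] E01[OF that, of r] insert.prems(2)
    unfolding g_def by simp
  \<comment> \<open>Integrating out the string preserves every \<open>t\<close>-th moment, so the
    induction hypothesis for \<open>g\<close> already has the desired right-hand side.\<close>
  have gt: "measure_pmf.expectation (Pi_pmf Sh dflt P) (\<lambda>r. g i r ^ t) =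
     measure_pmf.expectation (Pi_pmf (insert S Sh) dflt P) (\<lambda>r. f i r ^ t)" if i: "i \<in> I" for i
  proof -
    have "g i r ^ t = measure_pmf.expectation (P S) (\<lambda>y. f i (r(S := y)) ^ t)" for r
    proof (cases "i \<in> S")
      case True
      then show ?thesis using E01(1)[OF i, of r] insert.prems(2) by (simp add: g_def)
    next
      case False
      then show ?thesis by (simp add: g_def drop[OF i False])
    qed
    then have "measure_pmf.expectation (Pi_pmf Sh dflt P) (\<lambda>r. g i r ^ t) =
      measure_pmf.expectation (Pi_pmf Sh dflt P) (\<lambda>r. measure_pmf.expectation (P S) (\<lambda>y. f i (r(S := y)) ^ t))"
      by presburger
    also have "\<dots> = measure_pmf.expectation (Pi_pmf (insert S Sh) dflt P) (\<lambda>r. f i r ^ t)"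
      by (rule expectation_Pi_pmf_insert[symmetric]) (use insert.hyps ft[OF i] in auto)
    finally show ?thesis .
  qed
  have "measure_pmf.expectation (Pi_pmf (insert S Sh) dflt P) (\<lambda>r. \<Prod>i\<in>I. f i r) =
     measure_pmf.expectation (Pi_pmf Sh dflt P) (\<lambda>r. measure_pmf.expectation (P S) (\<lambda>y. \<Prod>i\<in>I. f i (r(S := y))))"
    by (rule expectation_Pi_pmf_insert; (intro prod_unit conjI)?; simp add: f01 insert.hyps)
  also have "\<dots> \<le> measure_pmf.expectation (Pi_pmf Sh dflt P) (\<lambda>r. \<Prod>i\<in>I. g i r)"
  proof (rule Bochner_Integration.integral_mono)
    show "integrable (measure_pmf (Pi_pmf Sh dflt P)) (\<lambda>r. measure_pmf.expectation (P S) (\<lambda>y. \<Prod>i\<in>I. f i (r(S := y))))"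
      by (intro integrable_pmf_unit expectation_unit; intro prod_unit; simp add: f01)
    show "integrable (measure_pmf (Pi_pmf Sh dflt P)) (\<lambda>r. \<Prod>i\<in>I. g i r)"
      by (intro integrable_pmf_unit; intro prod_unit; rule g01)
    fix r
    have eq: "(\<Prod>i\<in>I. h i) = (\<Prod>i\<in>I - S. h i) * (\<Prod>i\<in>S. h i)" for h :: "'i \<Rightarrow> real"
      using S(1) insert.prems(1) by (rule prod.subset_diff)
    have "measure_pmf.expectation (P S) (\<lambda>y. \<Prod>i\<in>I. f i (r(S := y))) =
       (\<Prod>i\<in>I - S. f i r) * measure_pmf.expectation (P S) (\<lambda>y. \<Prod>i\<in>S. f i (r(S := y)))"
      by (simp add: eq drop)
    also have "\<dots> \<le> (\<Prod>i\<in>I - S. f i r) * (\<Prod>i\<in>S. root t (measure_pmf.expectation (P S) (\<lambda>y. f i (r(S := y)) ^ t)))"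
      by (intro mult_left_mono holder_pmf prod_nonneg finS S(2) insert.prems(2)) (use S(1) f01 in auto)
    also have "\<dots> = (\<Prod>i\<in>I. g i r)"
      by (simp add: eq g_def)
    finally show "measure_pmf.expectation (P S) (\<lambda>y. \<Prod>i\<in>I. f i (r(S := y))) \<le> (\<Prod>i\<in>I. g i r)" .
  qed
  also have "\<dots> \<le> (\<Prod>i\<in>I. root t (measure_pmf.expectation (Pi_pmf Sh dflt P) (\<lambda>r. g i r ^ t)))"
  proof (rule insert.IH[OF insert.prems(1,2)])
    show "S' \<subseteq> I \<and> card S' = t" if "S' \<in> Sh" for S' using insert.prems(3) that by auto
    show "g i r = g i r'" if "i \<in> I" "\<And>S'. S' \<in> Sh \<Longrightarrow> i \<in> S' \<Longrightarrow> r S' = r' S'" for i r r'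
    proof -
      have "f i (r(S := y)) = f i (r'(S := y))" for y
        by (rule insert.prems(5)[OF that(1)]) (use that in auto)
      moreover have "f i r = f i r'" if "i \<notin> S"
        by (rule insert.prems(5)[OF \<open>i \<in> I\<close>]) (use that \<open>\<And>S'. S' \<in> Sh \<Longrightarrow> i \<in> S' \<Longrightarrow> r S' = r' S'\<close> in auto)
      ultimately show ?thesis by (simp add: g_def)
    qed
    show "0 \<le> g i r \<and> g i r \<le> 1" if "i \<in> I" for i r by (rule g01[OF that])
  qed
  also have "\<dots> = (\<Prod>i\<in>I. root t (measure_pmf.expectation (Pi_pmf (insert S Sh) dflt P) (\<lambda>r. f i r ^ t)))"
    by (intro prod.cong refl) (simp add: gt)
  finally show ?case .
qed

section \<open>The level-one inequality and product measurements\<close>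

text \<open>The Fourier coefficient at the singleton \<open>{j}\<close> of a matrix-valued function
  on the cube over \<open>A\<close>.\<close>

definition fcoef :: "nat set \<Rightarrow> (nat set \<Rightarrow> nat \<Rightarrow> nat \<Rightarrow> complex) \<Rightarrow> nat \<Rightarrow> nat \<Rightarrow> nat \<Rightarrow> complex" where
  "fcoef A F j = (\<lambda>a b. \<Sum>X\<in>Pow A. of_real (eps j X / 2 ^ card A) * F X a b)"

lemma Re_of_real_mult: "Re (complex_of_real c * z) = c * Re z"
  by simp

lemma fcoef_hermitian:
  "(\<And>X. X \<subseteq> A \<Longrightarrow> Defs.density d (F X)) \<Longrightarrow> hermitian_on d (fcoef A F j)"
  unfolding fcoef_def by (rule hermitian_on_scaled_sum) (auto intro: density_hermitian)

lemma fcoef_trace: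
  "(\<Sum>a<d. \<Sum>b<d. fcoef A F j a b * V b a) =
    (\<Sum>X\<in>Pow A. of_real (eps j X / 2 ^ card A) * (\<Sum>a<d. \<Sum>b<d. F X a b * V b a))"
proof -
  have "(\<Sum>a<d. \<Sum>b<d. fcoef A F j a b * V b a) =
     (\<Sum>a<d. \<Sum>b<d. \<Sum>X\<in>Pow A. of_real (eps j X / 2 ^ card A) * (F X a b * V b a))"
    by (simp add: fcoef_def sum_distrib_right mult.assoc)
  also have "\<dots> = (\<Sum>a<d. \<Sum>X\<in>Pow A. \<Sum>b<d. of_real (eps j X / 2 ^ card A) * (F X a b * V b a))"
    by (rule sum.cong[OF refl], rule sum.swap)
  also have "\<dots> = (\<Sum>X\<in>Pow A. \<Sum>a<d. \<Sum>b<d. of_real (eps j X / 2 ^ card A) * (F X a b * V b a))"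
    by (rule sum.swap)
  finally show ?thesis by (simp add: sum_distrib_left)
qed

text \<open>Pairing with the sign matrix turns the trace norm into a signed average of expectations,
  each in [-1,1].\<close>

lemma tnorm_fcoef_le_1:
  assumes A: "finite A" and F: "\<And>X. X \<subseteq> A \<Longrightarrow> Defs.density d (F X)"
  shows "tnorm d (fcoef A F j) \<le> 1"
proof -
  obtain V U s where V: "unitary_on d V" "diagonalizes d V U s" "\<And>l. \<bar>s l\<bar> = (1::real)"
    "(\<Sum>a<d. \<Sum>b<d. fcoef A F j a b * V b a) = complex_of_real (tnorm d (fcoef A F j))"
    using sign_matrix[OF fcoef_hermitian[of A d F j, OF F]] by blast
  define e where "e X = Re (\<Sum>a<d. \<Sum>b<d. F X a b * V b a)" for X
  have e: "\<bar>e X\<bar> \<le> 1" if X: "X \<subseteq> A" for X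
  proof -
    obtain w where w: "\<And>l. l < d \<Longrightarrow> 0 \<le> w l" "(\<Sum>l<d. w l) = 1"
      "(\<Sum>a<d. \<Sum>b<d. F X a b * V b a) = complex_of_real (\<Sum>l<d. w l * s l)"
      using density_expectation[OF F[OF X] V(2)] by blast
    have "\<bar>\<Sum>l<d. w l * s l\<bar> \<le> (\<Sum>l<d. \<bar>w l * s l\<bar>)" by (rule sum_abs)
    also have "\<dots> = (\<Sum>l<d. w l)" using w(1) V(3) by (simp add: abs_mult)
    finally show ?thesis unfolding e_def w(3) using w(2) by simp
  qed
  have "tnorm d (fcoef A F j) = Re (\<Sum>a<d. \<Sum>b<d. fcoef A F j a b * V b a)"
    unfolding V(4) by simp
  also have "\<dots> = (\<Sum>X\<in>Pow A. eps j X / 2 ^ card A * e X)"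
    unfolding fcoef_trace e_def Re_sum Re_of_real_mult ..
  also have "\<dots> \<le> (\<Sum>X\<in>Pow A. 1 / 2 ^ card A)"
  proof (rule sum_mono)
    fix X assume "X \<in> Pow A"
    then have "\<bar>eps j X / 2 ^ card A * e X\<bar> \<le> 1 / 2 ^ card A"
      using e[of X] by (simp add: abs_mult divide_right_mono)
    then show "eps j X / 2 ^ card A * e X \<le> 1 / 2 ^ card A" by linarith
  qed
  also have "\<dots> = 1" using A by (simp add: card_Pow)
  finally show ?thesis .
qed

text \<open>A density matrix of dimension one is the constant 1, whose character sum vanishes. This
  is the case of an empty message, where a moment of order \<open>2m\<close> would say
  nothing.\<close>

lemma fcoef_dim_1:
  assumes A: "finite A" "j \<in> A" and F: "\<And>X. X \<subseteq> A \<Longrightarrow> Defs.density 1 (F X)"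
  shows "tnorm 1 (fcoef A F j) = 0"
proof -
  have "fcoef A F j 0 0 = (\<Sum>X\<in>Pow A. of_real (eps j X / 2 ^ card A))"
    using F unfolding fcoef_def by (intro sum.cong refl) (simp add: Defs.density_def)
  also have "\<dots> = of_real ((\<Sum>X\<in>Pow A. chi {j} X) / 2 ^ card A)"
    by (simp add: chi_def sum_divide_distrib)
  also have "\<dots> = 0" using sum_chi[of A "{j}"] A by simp
  finally have z: "fcoef A F j 0 0 = 0" .
  obtain V U s where "unitary_on 1 V" "diagonalizes 1 V U s" "\<And>l. \<bar>s l\<bar> = (1::real)"
    "(\<Sum>a<1. \<Sum>b<1. fcoef A F j a b * V b a) = complex_of_real (tnorm 1 (fcoef A F j))"
    using sign_matrix[OF fcoef_hermitian[of A 1 F j, OF F]] by blast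
  then show ?thesis using z by simp
qed

text \<open>By duality the sum \<open>S\<close> of squares is the average over \<open>X\<close> of
  the expectation of \<open>H X\<close>, a random signed combination of sign matrices, in the state
  \<open>F X\<close>. Its \<open>2m\<close>-th power is at most \<open>2^m\<close> times a scalar
  Rademacher moment with coefficients \<open>a j\<close>, whose size is again governed by
  \<open>S\<close>; solving for \<open>S\<close> gives the bound.\<close>

lemma level_one_inequality:
  assumes A: "finite A" and F: "\<And>X. X \<subseteq> A \<Longrightarrow> Defs.density (2 ^ m) (F X)"
  shows "(\<Sum>j\<in>A. (tnorm (2 ^ m) (fcoef A F j))\<^sup>2) \<le> 24 * real m"
proof (cases "m = 0")
  case True
  then show ?thesis using fcoef_dim_1[of A _ F] A F by simp
next
  case m: False
  define d :: nat where "d = 2 ^ m"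
  define a where "a j = tnorm d (fcoef A F j)" for j
  define S where "S = (\<Sum>j\<in>A. (a j)\<^sup>2)"
  have F': "Defs.density d (F X)" if "X \<subseteq> A" for X using F[OF that] by (simp add: d_def)
  have a0: "0 \<le> a j" for j unfolding a_def by (intro tnorm_nonneg fcoef_hermitian F')
  have "\<exists>V. unitary_on d V \<and> hermitian_on d V \<and>
      (\<Sum>x<d. \<Sum>y<d. fcoef A F j x y * V y x) = complex_of_real (a j)" for j
  proof -
    obtain V U s where "unitary_on d V" "diagonalizes d V U s" "\<And>l. \<bar>s l\<bar> = (1::real)"
      "(\<Sum>x<d. \<Sum>y<d. fcoef A F j x y * V y x) = complex_of_real (tnorm d (fcoef A F j))"
      using sign_matrix[OF fcoef_hermitian[of A d F j, OF F']] by blast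
    then show ?thesis unfolding a_def by (intro exI[of _ V] conjI diagonalizes_hermitian[of d V U s])
  qed
  then have "\<exists>V. \<forall>j. unitary_on d (V j) \<and> hermitian_on d (V j) \<and>
      (\<Sum>x<d. \<Sum>y<d. fcoef A F j x y * V j y x) = complex_of_real (a j)"
    by (rule choice[OF allI])
  then obtain V where V': "\<forall>j. unitary_on d (V j) \<and> hermitian_on d (V j) \<and>
      (\<Sum>x<d. \<Sum>y<d. fcoef A F j x y * V j y x) = complex_of_real (a j)" ..
  have V: "unitary_on d (V j)" "hermitian_on d (V j)"
    "(\<Sum>x<d. \<Sum>y<d. fcoef A F j x y * V j y x) = complex_of_real (a j)" for j
    using V' by simp_all
  define H where "H X = (\<lambda>x y. \<Sum>j\<in>A. of_real (a j * eps j X) * V j x y)" for X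
  define y where "y X = Re (\<Sum>x<d. \<Sum>z<d. F X x z * H X z x)" for X
  have yX: "(\<Sum>x<d. \<Sum>z<d. F X x z * H X z x) =
     (\<Sum>j\<in>A. of_real (a j * eps j X) * (\<Sum>x<d. \<Sum>z<d. F X x z * V j z x))" for X
  proof -
    have "(\<Sum>x<d. \<Sum>z<d. F X x z * H X z x) =
       (\<Sum>x<d. \<Sum>z<d. \<Sum>j\<in>A. of_real (a j * eps j X) * (F X x z * V j z x))"
      by (simp add: H_def sum_distrib_left mult_ac)
    also have "\<dots> = (\<Sum>x<d. \<Sum>j\<in>A. \<Sum>z<d. of_real (a j * eps j X) * (F X x z * V j z x))"
      by (rule sum.cong[OF refl], rule sum.swap)
    also have "\<dots> = (\<Sum>j\<in>A. \<Sum>x<d. \<Sum>z<d. of_real (a j * eps j X) * (F X x z * V j z x))"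
      by (rule sum.swap)
    finally show ?thesis by (simp add: sum_distrib_left)
  qed
  \<comment> \<open>Exchanging the two sums turns the average over \<open>X\<close> of
    \<open>eps j X\<close> times the expectation of \<open>V j\<close> into \<open>a j\<close>, the
    pairing of the coefficient with its sign matrix.\<close>
  have S_eq: "S = (\<Sum>X\<in>Pow A. (1 / 2 ^ card A) * y X)"
  proof -
    have "(\<Sum>X\<in>Pow A. of_real (1 / 2 ^ card A) * (\<Sum>x<d. \<Sum>z<d. F X x z * H X z x)) =
       (\<Sum>X\<in>Pow A. \<Sum>j\<in>A. of_real (a j) * (of_real (eps j X / 2 ^ card A) * (\<Sum>x<d. \<Sum>z<d. F X x z * V j z x)))"
      unfolding yX by (simp add: sum_distrib_left mult_ac)
    also have "\<dots> = (\<Sum>j\<in>A. of_real (a j) * (\<Sum>X\<in>Pow A. of_real (eps j X / 2 ^ card A) * (\<Sum>x<d. \<Sum>z<d. F X x z * V j z x)))"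
      by (subst sum.swap) (simp only: sum_distrib_left)
    also have "\<dots> = (\<Sum>j\<in>A. of_real (a j) * of_real (a j))"
      unfolding fcoef_trace[symmetric] V(3) ..
    also have "\<dots> = complex_of_real S" by (simp add: S_def power2_eq_square)
    finally have "S = Re (\<Sum>X\<in>Pow A. of_real (1 / 2 ^ card A) * (\<Sum>x<d. \<Sum>z<d. F X x z * H X z x))"
      by simp
    then show ?thesis unfolding y_def Re_sum Re_of_real_mult .
  qed
  have "S ^ (2 * m) \<le> (\<Sum>X\<in>Pow A. (1 / 2 ^ card A) * y X ^ (2 * m))"
    unfolding S_eq using A convex_on_sum[of "Pow A" UNIV "\<lambda>x. x ^ (2 * m)" "\<lambda>_. 1 / 2 ^ card A" y]
    by (simp add: convex_power_even card_Pow Pow_not_empty del: power_mult)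
  also have "\<dots> = (1 / 2 ^ card A) * (\<Sum>X\<in>Pow A. y X ^ (2 * m))"
    by (simp add: sum_distrib_left)
  also have "(\<Sum>X\<in>Pow A. y X ^ (2 * m)) \<le> (\<Sum>X\<in>Pow A. Re (\<Sum>x<d. mpow d (H X) (2 * m) x x))"
    unfolding y_def H_def
    by (intro sum_mono density_moment_le_trace F' hermitian_on_scaled_sum V) auto
  also have "\<dots> \<le> real d * (\<Sum>X\<in>Pow A. (\<Sum>j\<in>A. a j * eps j X) ^ (2 * m))"
    unfolding H_def by (intro trace_moment_le A V a0)
  finally have S1: "S ^ (2 * m) \<le> (1 / 2 ^ card A) * (real d * (\<Sum>X\<in>Pow A. (\<Sum>j\<in>A. a j * eps j X) ^ (2 * m)))"
    by (simp add: divide_right_mono mult_left_mono)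
  have "S \<le> 24 * real m"
  proof (cases "S = 0")
    case False
    have "0 \<le> S" by (simp add: S_def sum_nonneg)
    then have S: "0 < S" using False by simp
    \<comment> \<open>This minimises the exponential divided by \<open>s ^ (2 * m)\<close>; the
      exponent becomes exactly \<open>m\<close>.\<close>
    define s where "s = sqrt (2 * real m / S)"
    have s: "s > 0" "s\<^sup>2 = 2 * real m / S" using S m by (simp_all add: s_def)
    have sq: "x ^ (2 * m) = x ^ m * x ^ m" for x :: real
      by (simp add: mult_2 power_add)
    have s2m: "s ^ (2 * m) = (2 * real m) ^ m / S ^ m"
      by (simp only: power_mult s(2) power_divide)
    have "S ^ m * (2 * real m) ^ m = S ^ (2 * m) * s ^ (2 * m)"
      unfolding s2m sq[of S] using S by simp
    also have "\<dots> \<le> (1 / 2 ^ card A) * (real d * (\<Sum>X\<in>Pow A. (\<Sum>j\<in>A. a j * eps j X) ^ (2 * m))) * s ^ (2 * m)"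
      using s(1) by (intro mult_right_mono S1) auto
    also have "\<dots> = (real d / 2 ^ card A) * ((\<Sum>X\<in>Pow A. (\<Sum>j\<in>A. a j * eps j X) ^ (2 * m)) * s ^ (2 * m))"
      by simp
    also have "\<dots> \<le> (real d / 2 ^ card A) * (2 ^ card A * (2 * fact (2 * m) * exp (s\<^sup>2 / 2 * (\<Sum>j\<in>A. (a j)\<^sup>2))))"
      by (intro mult_left_mono rademacher_moment A s) simp
    also have "\<dots> = real d * 2 * fact (2 * m) * exp (real m)"
      using S by (simp add: s(2) flip: S_def)
    also have "\<dots> \<le> real d * 2 * (2 * real m) ^ (2 * m) * 3 ^ m"
    proof -
      have "exp (real m) = exp 1 ^ m" by (simp add: exp_of_nat_mult[symmetric])
      also have "\<dots> \<le> 3 ^ m" by (intro power_mono exp_le) simp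
      finally have e: "exp (real m) \<le> 3 ^ m" .
      have "fact (2 * m) \<le> real (2 * m) ^ (2 * m)"
        using fact_le_power[of "2 * m", where 'a = real] by simp
      then show ?thesis using e by (intro mult_mono) auto
    qed
    also have "\<dots> = 2 * (12 * real m) ^ m * (2 * real m) ^ m"
    proof -
      have "(12 * real m) ^ m = 2 ^ m * 3 ^ m * (2 * real m) ^ m"
        by (subst power_mult_distrib[symmetric])+ simp
      then show ?thesis
        unfolding sq[of "2 * real m"] d_def by (simp only: of_nat_power of_nat_numeral mult_ac)
    qed
    finally have "S ^ m \<le> 2 * (12 * real m) ^ m"
      using m by (simp add: mult_le_cancel_right)
    \<comment> \<open>Since \<open>m \<ge> 1\<close>, the stray factor 2 is absorbed into the
      \<open>m\<close>-th power, which doubles 12 to 24.\<close>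
    also have "\<dots> \<le> 2 ^ m * (12 * real m) ^ m"
      using m self_le_power[of "2::real" m] by (intro mult_right_mono) auto
    also have "\<dots> = (24 * real m) ^ m" by (subst power_mult_distrib[symmetric]) simp
    finally show ?thesis by (subst (asm) power_mono_iff) (use m S in auto)
  qed simp
  then show ?thesis by (simp add: S_def a_def d_def)
qed

text \<open>Diagonalizing every factor writes the tensor product as a combination of projections
  onto product eigenvectors \<open>v l\<close> with coefficients the products of eigenvalues. Each
  \<open>v l\<close> is a unit vector, so its two outcome probabilities are nonnegative and sum to
  one; the absolute coefficients sum to the product of the trace norms. The index order
  \<open>b\<close>, \<open>a\<close> makes the double sum a trace.\<close>

lemma tensor_trace_le:
  fixes M :: "nat \<Rightarrow> nat \<Rightarrow> nat \<Rightarrow> complex"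
  assumes M: "\<And>i. i < k \<Longrightarrow> hermitian_on (2 ^ m i) (M i)"
    and E: "psd_on (multi_idx k m) E" "psd_on (multi_idx k m) E'"
    and povm: "\<And>a b. a \<in> multi_idx k m \<Longrightarrow> b \<in> multi_idx k m \<Longrightarrow> E a b + E' a b = (if a = b then 1 else 0)"
  shows "\<bar>Re (\<Sum>a\<in>multi_idx k m. \<Sum>b\<in>multi_idx k m. E a b * (\<Prod>i<k. M i (b i) (a i)))\<bar>
    \<le> (\<Prod>i<k. tnorm (2 ^ m i) (M i))"
proof -
  let ?I = "multi_idx k m"
  have fin: "finite ?I" unfolding multi_idx_def by (intro finite_PiE) auto
  have "\<exists>p. i < k \<longrightarrow> diagonalizes (2 ^ m i) (M i) (fst p) (snd p) \<and>
      tnorm (2 ^ m i) (M i) = (\<Sum>l<2 ^ m i. \<bar>snd p l\<bar>)" for i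
  proof (cases "i < k")
    case True
    obtain U \<mu> where "diagonalizes (2 ^ m i) (M i) U \<mu>" "tnorm (2 ^ m i) (M i) = (\<Sum>l<2 ^ m i. \<bar>\<mu> l\<bar>)"
      using tnorm_obtain[OF M[OF True]] by blast
    then show ?thesis by (intro exI[of _ "(U, \<mu>)"]) simp
  qed simp
  then have "\<exists>p. \<forall>i. i < k \<longrightarrow> diagonalizes (2 ^ m i) (M i) (fst (p i)) (snd (p i)) \<and>
      tnorm (2 ^ m i) (M i) = (\<Sum>l<2 ^ m i. \<bar>snd (p i) l\<bar>)"
    by (rule choice[OF allI])
  then obtain p where p: "\<forall>i. i < k \<longrightarrow> diagonalizes (2 ^ m i) (M i) (fst (p i)) (snd (p i)) \<and>
      tnorm (2 ^ m i) (M i) = (\<Sum>l<2 ^ m i. \<bar>snd (p i) l\<bar>)" ..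
  define U \<mu> where "U i = fst (p i)" and "\<mu> i = snd (p i)" for i
  have U: "diagonalizes (2 ^ m i) (M i) (U i) (\<mu> i)"
    and tn: "tnorm (2 ^ m i) (M i) = (\<Sum>l<2 ^ m i. \<bar>\<mu> i l\<bar>)" if "i < k" for i
    using p that by (simp_all add: U_def \<mu>_def)
  have uni: "unitary_on (2 ^ m i) (U i)" if "i < k" for i using U[OF that] by (simp add: diagonalizes_def)
  define v where "v l a = (\<Prod>i<k. U i (a i) (l i))" for l a :: "nat \<Rightarrow> nat"
  define Q where "Q X l = (\<Sum>a\<in>?I. \<Sum>b\<in>?I. cnj (v l a) * X a b * v l b)" for X l
  have memI: "a i < 2 ^ m i" if "a \<in> ?I" "i < k" for a i
    using that by (auto simp: multi_idx_def PiE_iff)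
  have prodM: "(\<Prod>i<k. M i (b i) (a i)) = (\<Sum>l\<in>?I. of_real (\<Prod>i<k. \<mu> i (l i)) * (cnj (v l a) * v l b))"
    if "a \<in> ?I" "b \<in> ?I" for a b
  proof -
    have "(\<Prod>i<k. M i (b i) (a i)) = (\<Prod>i<k. \<Sum>l<2 ^ m i. of_real (\<mu> i l) * U i (b i) l * cnj (U i (a i) l))"
      using U memI that by (intro prod.cong refl) (simp add: diagonalizes_def)
    also have "\<dots> = (\<Sum>l\<in>?I. \<Prod>i<k. of_real (\<mu> i (l i)) * U i (b i) (l i) * cnj (U i (a i) (l i)))"
      unfolding multi_idx_def by (rule prod_sum_PiE) auto
    finally show ?thesis by (simp add: v_def prod.distrib mult_ac)
  qed
  have "(\<Sum>a\<in>?I. \<Sum>b\<in>?I. E a b * (\<Prod>i<k. M i (b i) (a i))) =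
     (\<Sum>a\<in>?I. \<Sum>b\<in>?I. \<Sum>l\<in>?I. of_real (\<Prod>i<k. \<mu> i (l i)) * (cnj (v l a) * E a b * v l b))"
    by (intro sum.cong refl) (simp add: prodM sum_distrib_left mult_ac)
  also have "\<dots> = (\<Sum>a\<in>?I. \<Sum>l\<in>?I. \<Sum>b\<in>?I. of_real (\<Prod>i<k. \<mu> i (l i)) * (cnj (v l a) * E a b * v l b))"
    by (rule sum.cong[OF refl], rule sum.swap)
  also have "\<dots> = (\<Sum>l\<in>?I. \<Sum>a\<in>?I. \<Sum>b\<in>?I. of_real (\<Prod>i<k. \<mu> i (l i)) * (cnj (v l a) * E a b * v l b))"
    by (rule sum.swap)
  also have "\<dots> = (\<Sum>l\<in>?I. of_real (\<Prod>i<k. \<mu> i (l i)) * Q E l)"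
    by (simp only: Q_def sum_distrib_left)
  finally have tr: "(\<Sum>a\<in>?I. \<Sum>b\<in>?I. E a b * (\<Prod>i<k. M i (b i) (a i))) = (\<Sum>l\<in>?I. of_real (\<Prod>i<k. \<mu> i (l i)) * Q E l)" .
  have Qpos: "0 \<le> Re (Q X l)" if "psd_on ?I X" for X l
    using that unfolding psd_on_def Q_def by blast
  have Q1: "Q E l + Q E' l = 1" if l: "l \<in> ?I" for l
  proof -
    have "Q E l + Q E' l = (\<Sum>a\<in>?I. \<Sum>b\<in>?I. cnj (v l a) * (E a b + E' a b) * v l b)"
      by (simp only: Q_def sum.distrib distrib_left distrib_right)
    also have "\<dots> = (\<Sum>a\<in>?I. \<Sum>b\<in>?I. if a = b then cnj (v l a) * v l b else 0)"
      by (intro sum.cong refl) (simp add: povm)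
    also have "\<dots> = (\<Sum>a\<in>?I. cnj (v l a) * v l a)"
      using fin by (intro sum.cong refl) (simp add: sum.delta)
    also have "\<dots> = (\<Sum>a\<in>?I. \<Prod>i<k. cnj (U i (a i) (l i)) * U i (a i) (l i))"
      by (simp add: v_def prod.distrib)
    also have "\<dots> = (\<Prod>i<k. \<Sum>a<2 ^ m i. cnj (U i a (l i)) * U i a (l i))"
      unfolding multi_idx_def by (rule prod_sum_PiE[symmetric]) auto
    also have "\<dots> = 1"
      using uni memI[OF l] by (intro prod.neutral ballI) (simp add: unitary_on_def)
    finally show ?thesis .
  qed
  have Qle: "\<bar>Re (Q E l)\<bar> \<le> 1" if "l \<in> ?I" for l
    using arg_cong[OF Q1[OF that], of Re] Qpos[OF E(1), of l] Qpos[OF E(2), of l] by simp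
  have "\<bar>Re (\<Sum>l\<in>?I. of_real (\<Prod>i<k. \<mu> i (l i)) * Q E l)\<bar> = \<bar>\<Sum>l\<in>?I. (\<Prod>i<k. \<mu> i (l i)) * Re (Q E l)\<bar>"
    unfolding Re_sum Re_of_real_mult ..
  also have "\<dots> \<le> (\<Sum>l\<in>?I. \<bar>(\<Prod>i<k. \<mu> i (l i)) * Re (Q E l)\<bar>)"
    by (rule sum_abs)
  also have "\<dots> \<le> (\<Sum>l\<in>?I. \<Prod>i<k. \<bar>\<mu> i (l i)\<bar>)"
  proof (rule sum_mono)
    fix l assume "l \<in> ?I"
    then have "\<bar>\<Prod>i<k. \<mu> i (l i)\<bar> * \<bar>Re (Q E l)\<bar> \<le> \<bar>\<Prod>i<k. \<mu> i (l i)\<bar> * 1"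
      by (intro mult_left_mono Qle) auto
    then show "\<bar>(\<Prod>i<k. \<mu> i (l i)) * Re (Q E l)\<bar> \<le> (\<Prod>i<k. \<bar>\<mu> i (l i)\<bar>)"
      by (simp add: abs_mult abs_prod)
  qed
  also have "\<dots> = (\<Prod>i<k. \<Sum>l<2 ^ m i. \<bar>\<mu> i l\<bar>)"
    unfolding multi_idx_def by (rule prod_sum_PiE[symmetric]) auto
  also have "\<dots> = (\<Prod>i<k. tnorm (2 ^ m i) (M i))"
    by (intro prod.cong refl) (simp add: tn)
  finally show ?thesis unfolding tr .
qed

section \<open>Forcing coordinates greedily\<close>

lemma sum_PiE_Pow_split:
  assumes "J \<subseteq> N"
  shows "(\<Sum>x\<in>PiE I (\<lambda>_. Pow N). h x) =
    (\<Sum>w\<in>PiE I (\<lambda>_. Pow J). \<Sum>y\<in>PiE I (\<lambda>_. Pow (N - J)). h (\<lambda>i\<in>I. w i \<union> y i))"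
proof -
  have "(\<Sum>x\<in>PiE I (\<lambda>_. Pow N). h x) =
    (\<Sum>(w, y)\<in>PiE I (\<lambda>_. Pow J) \<times> PiE I (\<lambda>_. Pow (N - J)). h (\<lambda>i\<in>I. w i \<union> y i))"
  proof (rule sum.reindex_bij_witness[of _ "\<lambda>(w, y). (\<lambda>i\<in>I. w i \<union> y i)" "\<lambda>x. ((\<lambda>i\<in>I. x i \<inter> J), (\<lambda>i\<in>I. x i - J))"])
    fix x assume x: "x \<in> PiE I (\<lambda>_. Pow N)"
    then have "(\<lambda>i\<in>I. (\<lambda>i\<in>I. x i \<inter> J) i \<union> (\<lambda>i\<in>I. x i - J) i) = x"
      by (auto simp: fun_eq_iff PiE_iff extensional_def)
    then show "(case ((\<lambda>i\<in>I. x i \<inter> J), (\<lambda>i\<in>I. x i - J)) of (w, y) \<Rightarrow> (\<lambda>i\<in>I. w i \<union> y i)) = x"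
      "(case ((\<lambda>i\<in>I. x i \<inter> J), (\<lambda>i\<in>I. x i - J)) of (w, y) \<Rightarrow> h (\<lambda>i\<in>I. w i \<union> y i)) = h x"
      by simp_all
    show "((\<lambda>i\<in>I. x i \<inter> J), (\<lambda>i\<in>I. x i - J)) \<in> PiE I (\<lambda>_. Pow J) \<times> PiE I (\<lambda>_. Pow (N - J))"
      using x by (auto simp: PiE_iff)
  next
    fix p assume "p \<in> PiE I (\<lambda>_. Pow J) \<times> PiE I (\<lambda>_. Pow (N - J))"
    then obtain w y where p: "p = (w, y)" "w \<in> PiE I (\<lambda>_. Pow J)" "y \<in> PiE I (\<lambda>_. Pow (N - J))" by auto
    have "(w i \<union> y i) \<inter> J = w i" "(w i \<union> y i) - J = y i" if "i \<in> I" for i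
      using p(2,3) that by (auto simp: PiE_iff)
    then have "(\<lambda>i\<in>I. (w i \<union> y i) \<inter> J) = w" "(\<lambda>i\<in>I. (w i \<union> y i) - J) = y"
      using p(2,3) by (auto simp: fun_eq_iff PiE_iff extensional_def)
    then show "((\<lambda>i\<in>I. (case p of (w, y) \<Rightarrow> \<lambda>i\<in>I. w i \<union> y i) i \<inter> J),
       (\<lambda>i\<in>I. (case p of (w, y) \<Rightarrow> \<lambda>i\<in>I. w i \<union> y i) i - J)) = p"
      by (simp add: p(1) cong: restrict_cong)
    show "(case p of (w, y) \<Rightarrow> \<lambda>i\<in>I. w i \<union> y i) \<in> PiE I (\<lambda>_. Pow N)"
      using p assms by (auto simp: PiE_iff)
  qed
  then show ?thesis by (simp add: sum.cartesian_product)
qed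

text \<open>\<open>Sh\<close> may be any finite family of \<open>t\<close>-sets of players, and
  inputs are sets of coordinates. Locality is invariance under changes of unseen strings, the form
  in which Finner's inequality takes it. \<open>E\<close> is the accepting effect.\<close>

locale shared_protocol =
  fixes n k t :: nat and m :: "nat \<Rightarrow> nat" and Sh :: "nat set set" and P :: "nat set \<Rightarrow> nat pmf"
    and \<rho> :: "nat \<Rightarrow> nat set \<Rightarrow> (nat set \<Rightarrow> nat) \<Rightarrow> nat \<Rightarrow> nat \<Rightarrow> complex"
    and E E' :: "(nat \<Rightarrow> nat) \<Rightarrow> (nat \<Rightarrow> nat) \<Rightarrow> complex"
  assumes k: "k \<ge> 2" and t: "t \<ge> 2" and fin_Sh: "finite Sh"
    and Sh: "\<And>S. S \<in> Sh \<Longrightarrow> S \<subseteq> {..<k} \<and> card S = t"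
    and density: "\<And>i X r. i < k \<Longrightarrow> X \<subseteq> {..<n} \<Longrightarrow> Defs.density (2 ^ m i) (\<rho> i X r)"
    and local: "\<And>i X r r'. i < k \<Longrightarrow> (\<And>S. S \<in> Sh \<Longrightarrow> i \<in> S \<Longrightarrow> r S = r' S) \<Longrightarrow> \<rho> i X r = \<rho> i X r'"
    and psd: "psd_on (multi_idx k m) E" "psd_on (multi_idx k m) E'"
    and povm: "\<And>a b. a \<in> multi_idx k m \<Longrightarrow> b \<in> multi_idx k m \<Longrightarrow> E a b + E' a b = (if a = b then 1 else 0)"
begin

definition inputs :: "(nat \<Rightarrow> nat set) set" where
  "inputs = PiE {..<k} (\<lambda>_. Pow {..<n})"

definition rand :: "(nat set \<Rightarrow> nat) pmf" where
  "rand = Pi_pmf Sh 0 P"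

definition accept :: "(nat \<Rightarrow> nat set) \<Rightarrow> (nat set \<Rightarrow> nat) \<Rightarrow> real" where
  "accept x r = Re (\<Sum>a\<in>multi_idx k m. \<Sum>b\<in>multi_idx k m. E a b * (\<Prod>i<k. \<rho> i (x i) r (b i) (a i)))"

definition G :: "(nat \<Rightarrow> nat set) \<Rightarrow> real" where
  "G x = measure_pmf.expectation rand (accept x)"

text \<open>Each factor is 2 if the parity sign at \<open>j\<close> equals \<open>\<sigma>\<close>
  and 0 if it is the opposite sign: an unnormalised indicator of forced parities. With
  \<open>J\<close> empty it is the uniform distribution.\<close>

definition W :: "nat set \<Rightarrow> real \<Rightarrow> (nat \<Rightarrow> nat set) \<Rightarrow> real" where
  "W J \<sigma> x = (\<Prod>j\<in>J. 1 + \<sigma> * (\<Prod>i<k. eps j (x i)))"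

definition T :: "nat set \<Rightarrow> real \<Rightarrow> real" where
  "T J \<sigma> = (\<Sum>x\<in>inputs. W J \<sigma> x * G x)"

definition coef :: "nat set \<Rightarrow> nat \<Rightarrow> nat \<Rightarrow> (nat set \<Rightarrow> nat) \<Rightarrow> nat set \<Rightarrow> real" where
  "coef J j i r w = tnorm (2 ^ m i) (fcoef ({..<n} - J) (\<lambda>y. \<rho> i (w \<union> y) r) j)"

text \<open>The root mean square of \<open>coef\<close> over uniform inputs \<open>w\<close> on the
  forced coordinates, for a fixed value of the shared strings.\<close>

definition F :: "nat set \<Rightarrow> nat \<Rightarrow> nat \<Rightarrow> (nat set \<Rightarrow> nat) \<Rightarrow> real" where
  "F J j i r = sqrt ((\<Sum>w\<in>Pow J. (coef J j i r w)\<^sup>2) / 2 ^ card J)"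

text \<open>The quantity \<open>a i j\<close> of the overview, given that \<open>J\<close> is
  forced.\<close>

definition infl :: "nat set \<Rightarrow> nat \<Rightarrow> nat \<Rightarrow> real" where
  "infl J j i = measure_pmf.expectation rand (\<lambda>r. (F J j i r)\<^sup>2)"

lemma inputsD: "x \<in> inputs \<Longrightarrow> i < k \<Longrightarrow> x i \<subseteq> {..<n}"
  by (auto simp: inputs_def PiE_iff)

lemma abs_accept_le_1: "\<bar>accept x r\<bar> \<le> 1" if x: "x \<in> inputs"
proof -
  have d: "Defs.density (2 ^ m i) (\<rho> i (x i) r)" if "i < k" for i
    using density inputsD[OF x] that by blast
  have "\<bar>accept x r\<bar> \<le> (\<Prod>i<k. tnorm (2 ^ m i) (\<rho> i (x i) r))"
    unfolding accept_def by (rule tensor_trace_le[OF density_hermitian[OF d] psd povm])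
  also have "\<dots> \<le> 1"
  proof (rule prod_le_1)
    fix i assume "i \<in> {..<k}"
    then have i: "i < k" by simp
    \<comment> \<open>Over an empty set of coordinates a density matrix is its own coefficient, so
      the bound for coefficients also yields trace norm at most one.\<close>
    have "fcoef {} (\<lambda>_. \<rho> i (x i) r) 0 = \<rho> i (x i) r"
      by (simp add: fcoef_def eps_def)
    then show "0 \<le> tnorm (2 ^ m i) (\<rho> i (x i) r) \<and> tnorm (2 ^ m i) (\<rho> i (x i) r) \<le> 1"
      using tnorm_fcoef_le_1[of "{}" "2 ^ m i" "\<lambda>_. \<rho> i (x i) r" 0] d[OF i]
        tnorm_nonneg[OF density_hermitian[OF d[OF i]]] by simp
  qed
  finally show ?thesis .
qed

lemma integrable_accept: "x \<in> inputs \<Longrightarrow> integrable (measure_pmf rand) (accept x)"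
  by (rule measure_pmf.integrable_const_bound[of _ 1]) (simp_all add: abs_accept_le_1)

lemma abs_prod_eps: "\<bar>\<Prod>i<k. eps j (x i)\<bar> = 1"
  by (simp add: abs_prod)

lemma W_nonneg: "0 \<le> W J \<sigma> x" if "\<bar>\<sigma>\<bar> = 1"
  unfolding W_def
proof (rule prod_nonneg)
  fix j
  have "\<bar>\<sigma> * (\<Prod>i<k. eps j (x i))\<bar> = 1" by (simp add: abs_mult that abs_prod_eps)
  then show "0 \<le> 1 + \<sigma> * (\<Prod>i<k. eps j (x i))" by linarith
qed

context
  fixes J j
  assumes J: "J \<subseteq> {..<n}" and j: "j < n" "j \<notin> J"
begin

lemma fin_J: "finite J"
  using J finite_subset by blast

lemma density_union:
  "i < k \<Longrightarrow> w \<subseteq> J \<Longrightarrow> y \<subseteq> {..<n} - J \<Longrightarrow> Defs.density (2 ^ m i) (\<rho> i (w \<union> y) r)"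
  using J by (intro density) auto

lemma coef_bounds: "0 \<le> coef J j' i r w" "coef J j' i r w \<le> 1" if "i < k" "w \<subseteq> J"
  unfolding coef_def using density_union that
  by (intro tnorm_nonneg fcoef_hermitian tnorm_fcoef_le_1; simp)+

lemma F_bounds: "0 \<le> F J j' i r" "F J j' i r \<le> 1" if "i < k"
proof -
  show "0 \<le> F J j' i r" by (simp add: F_def sum_nonneg)
  have "(\<Sum>w\<in>Pow J. (coef J j' i r w)\<^sup>2) \<le> (\<Sum>w\<in>Pow J. 1)"
    using coef_bounds[OF that] by (intro sum_mono) (simp add: abs_square_le_1)
  also have "\<dots> = 2 ^ card J" by (simp add: card_Pow fin_J)
  finally show "F J j' i r \<le> 1" by (simp add: F_def)
qed

lemma F_local: "F J j' i r = F J j' i r'"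
  if "i < k" "\<And>S. S \<in> Sh \<Longrightarrow> i \<in> S \<Longrightarrow> r S = r' S"
proof -
  have "\<rho> i X r = \<rho> i X r'" for X using local that by blast
  then show ?thesis by (simp add: F_def coef_def)
qed

text \<open>The input splits into \<open>w\<close> on \<open>J\<close> and \<open>y\<close> off
  \<open>J\<close>. The weight depends only on \<open>w\<close>, the sign at \<open>j\<close> only
  on \<open>y\<close>. The sum over \<open>y\<close> factorises over the players into level-one
  coefficients, measured jointly by the referee; the sum over \<open>w\<close> is coupled by the
  parities and is bounded by root mean squares.\<close>

lemma pointwise_increment:
  assumes \<sigma>: "\<bar>\<sigma>\<bar> = 1"
  shows "\<bar>\<Sum>x\<in>inputs. W J \<sigma> x * (\<Prod>i<k. eps j (x i)) * accept x r\<bar> \<le> (2 ^ n) ^ k * (\<Prod>i<k. F J j i r)"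
proof -
  let ?I = "multi_idx k m" and ?C = "{..<n} - J"
  let ?PJ = "PiE {..<k} (\<lambda>_. Pow J)" and ?PC = "PiE {..<k} (\<lambda>_. Pow ?C)"
  define M where "M w i = fcoef ?C (\<lambda>y. \<rho> i (w i \<union> y) r) j" for w i
  have inner: "(\<Sum>y\<in>?PC. (\<Prod>i<k. eps j (y i)) * accept (\<lambda>i\<in>{..<k}. w i \<union> y i) r) =
     (2 ^ card ?C) ^ k * Re (\<Sum>a\<in>?I. \<Sum>b\<in>?I. E a b * (\<Prod>i<k. M w i (b i) (a i)))" for w
  proof -
    have M: "(\<Prod>i<k. 2 ^ card ?C * M w i (b i) (a i)) =
       (\<Sum>y\<in>?PC. of_real (\<Prod>i<k. eps j (y i)) * (\<Prod>i<k. \<rho> i (w i \<union> y i) r (b i) (a i)))" for a b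
    proof -
      have "(\<Prod>i<k. 2 ^ card ?C * M w i (b i) (a i)) =
         (\<Prod>i<k. \<Sum>y\<in>Pow ?C. of_real (eps j y) * \<rho> i (w i \<union> y) r (b i) (a i))"
        by (simp add: M_def fcoef_def sum_distrib_left)
      also have "\<dots> = (\<Sum>y\<in>?PC. \<Prod>i<k. of_real (eps j (y i)) * \<rho> i (w i \<union> y i) r (b i) (a i))"
        by (rule prod_sum_PiE) auto
      finally show ?thesis by (simp add: prod.distrib)
    qed
    have "complex_of_real ((2 ^ card ?C) ^ k) * (\<Sum>a\<in>?I. \<Sum>b\<in>?I. E a b * (\<Prod>i<k. M w i (b i) (a i))) =
       (\<Sum>a\<in>?I. \<Sum>b\<in>?I. E a b * (\<Prod>i<k. 2 ^ card ?C * M w i (b i) (a i)))"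
      by (simp add: sum_distrib_left prod.distrib mult.left_commute)
    also have "\<dots> = (\<Sum>a\<in>?I. \<Sum>b\<in>?I. \<Sum>y\<in>?PC. of_real (\<Prod>i<k. eps j (y i)) * (E a b * (\<Prod>i<k. \<rho> i (w i \<union> y i) r (b i) (a i))))"
      by (simp only: M sum_distrib_left mult.left_commute)
    also have "\<dots> = (\<Sum>a\<in>?I. \<Sum>y\<in>?PC. \<Sum>b\<in>?I. of_real (\<Prod>i<k. eps j (y i)) * (E a b * (\<Prod>i<k. \<rho> i (w i \<union> y i) r (b i) (a i))))"
      by (rule sum.cong[OF refl], rule sum.swap)
    also have "\<dots> = (\<Sum>y\<in>?PC. \<Sum>a\<in>?I. \<Sum>b\<in>?I. of_real (\<Prod>i<k. eps j (y i)) * (E a b * (\<Prod>i<k. \<rho> i (w i \<union> y i) r (b i) (a i))))"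
      by (rule sum.swap)
    also have "\<dots> = (\<Sum>y\<in>?PC. of_real (\<Prod>i<k. eps j (y i)) * (\<Sum>a\<in>?I. \<Sum>b\<in>?I. E a b * (\<Prod>i<k. \<rho> i (w i \<union> y i) r (b i) (a i))))"
      by (simp only: sum_distrib_left)
    finally have "Re (complex_of_real ((2 ^ card ?C) ^ k) * (\<Sum>a\<in>?I. \<Sum>b\<in>?I. E a b * (\<Prod>i<k. M w i (b i) (a i)))) =
      Re (\<Sum>y\<in>?PC. of_real (\<Prod>i<k. eps j (y i)) * (\<Sum>a\<in>?I. \<Sum>b\<in>?I. E a b * (\<Prod>i<k. \<rho> i (w i \<union> y i) r (b i) (a i))))"
      by (rule arg_cong)
    note eq = this
    have accept: "accept (\<lambda>i\<in>{..<k}. w i \<union> y i) r =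
      Re (\<Sum>a\<in>?I. \<Sum>b\<in>?I. E a b * (\<Prod>i<k. \<rho> i (w i \<union> y i) r (b i) (a i)))" for y
      unfolding accept_def
      by (intro arg_cong[where f = Re] sum.cong refl arg_cong2[where f = "(*)"] prod.cong) simp
    show ?thesis using eq[symmetric] unfolding accept Re_sum Re_of_real_mult .
  qed
  have bound: "\<bar>Re (\<Sum>a\<in>?I. \<Sum>b\<in>?I. E a b * (\<Prod>i<k. M w i (b i) (a i)))\<bar> \<le> (\<Prod>i<k. coef J j i r (w i))"
    if w: "w \<in> ?PJ" for w
  proof -
    have wi: "w i \<subseteq> J" if "i < k" for i using w that by (auto simp: PiE_iff)
    have "hermitian_on (2 ^ m i) (M w i)" if "i < k" for i
      unfolding M_def by (rule fcoef_hermitian) (rule density_union[OF that wi[OF that]])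
    then show ?thesis
      using tensor_trace_le[of k m "M w", OF _ psd povm] unfolding coef_def M_def by simp
  qed
  have split: "W J \<sigma> (\<lambda>i\<in>{..<k}. w i \<union> y i) * (\<Prod>i<k. eps j ((\<lambda>i\<in>{..<k}. w i \<union> y i) i)) = W J \<sigma> w * (\<Prod>i<k. eps j (y i))"
    if "w \<in> ?PJ" "y \<in> ?PC" for w y
  proof -
    have "eps j' (w i \<union> y i) = eps j' (w i)" if "i < k" "j' \<in> J" for i j'
      using \<open>y \<in> ?PC\<close> that by (auto simp: eps_def PiE_iff)
    moreover have "eps j (w i \<union> y i) = eps j (y i)" if "i < k" for i
      using \<open>w \<in> ?PJ\<close> that j by (auto simp: eps_def PiE_iff)
    ultimately show ?thesis by (simp add: W_def)
  qed
  have "(\<Sum>x\<in>inputs. W J \<sigma> x * (\<Prod>i<k. eps j (x i)) * accept x r) =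
     (\<Sum>w\<in>?PJ. \<Sum>y\<in>?PC. W J \<sigma> w * ((\<Prod>i<k. eps j (y i)) * accept (\<lambda>i\<in>{..<k}. w i \<union> y i) r))"
    unfolding inputs_def sum_PiE_Pow_split[OF J]
    by (intro sum.cong refl) (simp only: split mult.assoc)
  also have "\<dots> = (\<Sum>w\<in>?PJ. W J \<sigma> w * ((2 ^ card ?C) ^ k * Re (\<Sum>a\<in>?I. \<Sum>b\<in>?I. E a b * (\<Prod>i<k. M w i (b i) (a i)))))"
    by (simp only: sum_distrib_left[symmetric] inner)
  finally have "\<bar>\<Sum>x\<in>inputs. W J \<sigma> x * (\<Prod>i<k. eps j (x i)) * accept x r\<bar> \<le>
     (\<Sum>w\<in>?PJ. \<bar>W J \<sigma> w * ((2 ^ card ?C) ^ k * Re (\<Sum>a\<in>?I. \<Sum>b\<in>?I. E a b * (\<Prod>i<k. M w i (b i) (a i))))\<bar>)"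
    by (simp only: sum_abs)
  also have "\<dots> \<le> (\<Sum>w\<in>?PJ. W J \<sigma> w * ((2 ^ card ?C) ^ k * (\<Prod>i<k. coef J j i r (w i))))"
  proof (rule sum_mono)
    fix w assume "w \<in> ?PJ"
    then show "\<bar>W J \<sigma> w * ((2 ^ card ?C) ^ k * Re (\<Sum>a\<in>?I. \<Sum>b\<in>?I. E a b * (\<Prod>i<k. M w i (b i) (a i))))\<bar>
      \<le> W J \<sigma> w * ((2 ^ card ?C) ^ k * (\<Prod>i<k. coef J j i r (w i)))"
      unfolding abs_mult using W_nonneg[OF \<sigma>, of J w] bound
      by (intro mult_mono mult_left_mono) auto
  qed
  also have "\<dots> = (2 ^ card ?C) ^ k * (\<Sum>w\<in>?PJ. W J \<sigma> w * (\<Prod>i<k. coef J j i r (w i)))"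
    by (simp only: sum_distrib_left mult.left_commute)
  also have "\<dots> \<le> (2 ^ card ?C) ^ k * (\<Prod>i<k. sqrt (2 ^ card J * (\<Sum>w\<in>Pow J. (coef J j i r w)\<^sup>2)))"
    unfolding W_def using k by (intro mult_left_mono sum_parity_weight_prod_le[OF fin_J _ \<sigma>]) auto
  also have "(\<Prod>i<k. sqrt (2 ^ card J * (\<Sum>w\<in>Pow J. (coef J j i r w)\<^sup>2))) = (\<Prod>i<k. 2 ^ card J * F J j i r)"
  proof (intro prod.cong refl)
    fix i
    have "2 ^ card J * (\<Sum>w\<in>Pow J. (coef J j i r w)\<^sup>2) = (2 ^ card J)\<^sup>2 * ((\<Sum>w\<in>Pow J. (coef J j i r w)\<^sup>2) / 2 ^ card J)"
      by (simp add: power2_eq_square)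
    moreover have "sqrt ((2 ^ card J)\<^sup>2 * y) = 2 ^ card J * sqrt y" for y
      by (simp add: real_sqrt_mult)
    ultimately show "sqrt (2 ^ card J * (\<Sum>w\<in>Pow J. (coef J j i r w)\<^sup>2)) = 2 ^ card J * F J j i r"
      unfolding F_def by (simp only:)
  qed
  also have "(2 ^ card ?C) ^ k * (\<Prod>i<k. 2 ^ card J * F J j i r) = (2 ^ n) ^ k * (\<Prod>i<k. F J j i r)"
  proof -
    have "card J \<le> n" using card_mono[OF _ J] by simp
    then have "(2::real) ^ card ?C * 2 ^ card J = 2 ^ n"
      using J fin_J by (simp add: card_Diff_subset flip: power_add)
    then show ?thesis by (simp add: prod.distrib flip: power_mult_distrib)
  qed
  finally show ?thesis .
qed

text \<open>The new weight minus the old one is \<open>\<sigma>\<close> times the old weight times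
  the product of signs at \<open>j\<close>. Finner's inequality then separates the players, and
  \<open>0 \<le> F \<le> 1\<close> with \<open>t \<ge> 2\<close> lets second moments replace
  \<open>t\<close>-th ones.\<close>

lemma T_increment:
  assumes \<sigma>: "\<bar>\<sigma>\<bar> = 1"
  shows "\<bar>T (insert j J) \<sigma> - T J \<sigma>\<bar> \<le> (2 ^ n) ^ k * (\<Prod>i<k. root t (infl J j i))"
proof -
  let ?D = "\<lambda>r. \<Sum>x\<in>inputs. W J \<sigma> x * (\<Prod>i<k. eps j (x i)) * accept x r"
  have int_D: "integrable (measure_pmf rand) ?D"
    by (intro Bochner_Integration.integrable_sum integrable_mult_right integrable_accept)
  have "T (insert j J) \<sigma> - T J \<sigma> = (\<Sum>x\<in>inputs. \<sigma> * (W J \<sigma> x * (\<Prod>i<k. eps j (x i)) * G x))"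
    unfolding T_def sum_subtractf[symmetric] using fin_J j
    by (intro sum.cong refl) (simp add: W_def algebra_simps)
  also have "\<dots> = \<sigma> * measure_pmf.expectation rand ?D"
    by (simp add: G_def Bochner_Integration.integral_sum integrable_accept sum_distrib_left)
  finally have "\<bar>T (insert j J) \<sigma> - T J \<sigma>\<bar> = \<bar>measure_pmf.expectation rand ?D\<bar>"
    by (simp add: abs_mult \<sigma>)
  also have "\<dots> \<le> measure_pmf.expectation rand (\<lambda>r. \<bar>?D r\<bar>)"
    by (rule integral_abs_bound)
  also have "\<dots> \<le> measure_pmf.expectation rand (\<lambda>r. (2 ^ n) ^ k * (\<Prod>i<k. F J j i r))"
  proof (rule Bochner_Integration.integral_mono)
    show "integrable (measure_pmf rand) (\<lambda>r. \<bar>?D r\<bar>)" using int_D by (rule integrable_abs)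
    show "integrable (measure_pmf rand) (\<lambda>r. (2 ^ n) ^ k * (\<Prod>i<k. F J j i r))"
      by (intro integrable_mult_right integrable_pmf_unit; intro prod_unit; simp add: F_bounds)
  qed (rule pointwise_increment[OF \<sigma>])
  also have "\<dots> = (2 ^ n) ^ k * measure_pmf.expectation rand (\<lambda>r. \<Prod>i<k. F J j i r)"
    by simp
  also have "\<dots> \<le> (2 ^ n) ^ k * (\<Prod>i<k. root t (measure_pmf.expectation rand (\<lambda>r. F J j i r ^ t)))"
    unfolding rand_def
  proof (intro mult_left_mono finner_pmf)
    show "\<And>i r r'. i \<in> {..<k} \<Longrightarrow> (\<And>S. S \<in> Sh \<Longrightarrow> i \<in> S \<Longrightarrow> r S = r' S) \<Longrightarrow> F J j i r = F J j i r'"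
      by (rule F_local) auto
  qed (use fin_Sh Sh t F_bounds in auto)
  also have "\<dots> \<le> (2 ^ n) ^ k * (\<Prod>i<k. root t (infl J j i))"
  proof (intro mult_left_mono prod_mono conjI)
    fix i assume "i \<in> {..<k}"
    then have i: "i < k" by simp
    have b: "0 \<le> F J j i r ^ q" "F J j i r ^ q \<le> 1" for r q
      using F_bounds[OF i, of j r] by (auto simp: power_le_one)
    have "0 \<le> measure_pmf.expectation rand (\<lambda>r. F J j i r ^ t)"
      by (rule expectation_unit; rule b)
    then show "0 \<le> root t (measure_pmf.expectation rand (\<lambda>r. F J j i r ^ t))"
      using t by simp
    have "F J j i r ^ t \<le> (F J j i r)\<^sup>2" for r
      using F_bounds[OF i, of j r] t by (intro power_decreasing) auto
    then have "measure_pmf.expectation rand (\<lambda>r. F J j i r ^ t) \<le> infl J j i"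
      unfolding infl_def
      by (intro Bochner_Integration.integral_mono integrable_pmf_unit b)
    then show "root t (measure_pmf.expectation rand (\<lambda>r. F J j i r ^ t)) \<le> root t (infl J j i)"
      using t by simp
  qed simp
  finally show ?thesis .
qed

lemma infl_nonneg: "i < k \<Longrightarrow> 0 \<le> infl J j' i"
  unfolding infl_def by (rule Bochner_Integration.integral_nonneg) simp

text \<open>The level-one inequality on the free coordinates holds for each fixed value of the
  strings and of the input on \<open>J\<close>, hence also on average.\<close>

lemma sum_infl_le: "(\<Sum>j'\<in>{..<n} - J. infl J j' i) \<le> 24 * real (m i)" if i: "i < k"
proof -
  have "(\<Sum>j'\<in>{..<n} - J. infl J j' i) = measure_pmf.expectation rand (\<lambda>r. \<Sum>j'\<in>{..<n} - J. (F J j' i r)\<^sup>2)"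
    unfolding infl_def using F_bounds[OF i]
    by (intro Bochner_Integration.integral_sum[symmetric] integrable_pmf_unit) (auto simp: power_le_one)
  also have "\<dots> \<le> measure_pmf.expectation rand (\<lambda>r. 24 * real (m i))"
  proof (rule Bochner_Integration.integral_mono)
    show "integrable (measure_pmf rand) (\<lambda>r. \<Sum>j'\<in>{..<n} - J. (F J j' i r)\<^sup>2)"
      using F_bounds[OF i]
      by (intro Bochner_Integration.integrable_sum integrable_pmf_unit) (auto simp: power_le_one)
    fix r
    have "(\<Sum>j'\<in>{..<n} - J. (F J j' i r)\<^sup>2) = (\<Sum>j'\<in>{..<n} - J. \<Sum>w\<in>Pow J. (coef J j' i r w)\<^sup>2 / 2 ^ card J)"
      by (simp add: F_def sum_nonneg sum_divide_distrib)
    also have "\<dots> = (\<Sum>w\<in>Pow J. (\<Sum>j'\<in>{..<n} - J. (coef J j' i r w)\<^sup>2) / 2 ^ card J)"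
      by (subst sum.swap) (simp add: sum_divide_distrib)
    also have "\<dots> \<le> (\<Sum>w\<in>Pow J. 24 * real (m i) / 2 ^ card J)"
      unfolding coef_def using density_union[OF i]
      by (intro sum_mono divide_right_mono level_one_inequality) auto
    also have "\<dots> = 24 * real (m i)" by (simp add: card_Pow fin_J)
    finally show "(\<Sum>j'\<in>{..<n} - J. (F J j' i r)\<^sup>2) \<le> 24 * real (m i)" .
  qed simp
  finally show ?thesis by simp
qed

end

section \<open>The greedy walk and its length\<close>

definition \<mu> :: real where
  "\<mu> = real (\<Sum>i<k. m i) / real k"

definition \<delta> :: real where
  "\<delta> = (72 * \<mu> / real n) powr (real k / real t)"

text \<open>At least \<open>n/3\<close> coordinates are free while the total influence over them is
  at most 24 times the cost, so some \<open>j\<close> has total at most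
  \<open>72 * k * \<mu> / n\<close>. AM-GM over the players turns this into a bound on the
  product.\<close>

lemma ex_low_influence:
  assumes J: "J \<subseteq> {..<n}" and cJ: "3 * card J \<le> 2 * n" and n: "n > 0"
  obtains j where "j < n" "j \<notin> J" "(\<Prod>i<k. root t (infl J j i)) \<le> \<delta>"
proof -
  let ?C = "{..<n} - J"
  have finJ: "finite J" using J finite_subset by blast
  have cC: "card ?C = n - card J" using J finJ by (simp add: card_Diff_subset)
  have C: "real n \<le> 3 * real (card ?C)" using cJ cC by linarith
  then have ne: "?C \<noteq> {}" using n by (metis card.empty mult_zero_right not_less of_nat_0 of_nat_0_less_iff)
  then obtain j0 where j0: "j0 < n" "j0 \<notin> J" by auto
  define s where "s j = (\<Sum>i<k. infl J j i)" for j
  have "\<exists>j\<in>?C. s j \<le> 72 * real k * \<mu> / real n"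
  proof (rule ccontr)
    assume "\<not> ?thesis"
    then have gt: "72 * real k * \<mu> / real n < s j" if "j \<in> ?C" for j
      using that by (auto simp: not_le)
    have mu: "real k * \<mu> = real (\<Sum>i<k. m i)" using k by (simp add: \<mu>_def)
    define K where "K = real k * \<mu>"
    have "0 \<le> K" unfolding K_def mu by (simp add: sum_nonneg)
    then have "24 * K * real n \<le> 24 * K * (3 * real (card ?C))"
      using C by (intro mult_left_mono) auto
    then have "24 * K \<le> 72 * K * real (card ?C) / real n"
      using n by (simp add: field_simps)
    also have "\<dots> = (\<Sum>j\<in>?C. 72 * real k * \<mu> / real n)" by (simp add: K_def)
    also have "\<dots> < (\<Sum>j\<in>?C. s j)" using gt ne by (intro sum_strict_mono) auto
    also have "\<dots> = (\<Sum>i<k. \<Sum>j\<in>?C. infl J j i)" unfolding s_def by (rule sum.swap)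
    also have "\<dots> \<le> (\<Sum>i<k. 24 * real (m i))"
      by (intro sum_mono sum_infl_le[OF J j0]) auto
    also have "\<dots> = 24 * K" unfolding K_def mu by (simp add: sum_distrib_left)
    finally show False by simp
  qed
  then obtain j where j: "j < n" "j \<notin> J" "s j \<le> 72 * real k * \<mu> / real n" by auto
  have nn: "0 \<le> infl J j i" if "i < k" for i by (rule infl_nonneg[OF J j0 that])
  have "(\<Prod>i<k. infl J j i) powr (1 / card {..<k}) \<le> (\<Sum>i<k. infl J j i / card {..<k})"
    using k nn by (intro arith_geom_mean) (auto simp: lessThan_empty_iff)
  also have "\<dots> = s j / real k" by (simp add: s_def sum_divide_distrib)
  also have "\<dots> \<le> 72 * \<mu> / real n" using j(3) k by (simp add: field_simps)
  finally have am: "(\<Prod>i<k. infl J j i) powr (1 / real k) \<le> 72 * \<mu> / real n" by simp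
  have "(\<Prod>i<k. root t (infl J j i)) = (\<Prod>i<k. infl J j i powr (1 / real t))"
  proof (intro prod.cong refl)
    fix i assume "i \<in> {..<k}"
    then have "0 \<le> infl J j i" using nn by simp
    then show "root t (infl J j i) = infl J j i powr (1 / real t)"
      using t by (cases "infl J j i = 0") (auto simp: root_powr_inverse)
  qed
  also have "\<dots> = (\<Prod>i<k. infl J j i) powr (1 / real t)"
    using nn by (simp add: prod_powr_distrib)
  also have "\<dots> = ((\<Prod>i<k. infl J j i) powr (1 / real k)) powr (real k / real t)"
    using k by (simp add: powr_powr)
  also have "\<dots> \<le> \<delta>" unfolding \<delta>_def using am by (intro powr_mono2) auto
  finally show thesis using that j by blast
qed

text \<open>Influences do not involve \<open>\<sigma>\<close>, so one set \<open>B\<close> serves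
  both walks. The slack of 3 in the bound on \<open>l\<close> allows a last step from a set that
  still satisfies \<open>3 * card B \<le> 2 * n\<close>.\<close>

lemma greedy:
  assumes n: "n > 0" and l: "3 * l \<le> 2 * n + 3"
  shows "\<exists>B\<subseteq>{..<n}. card B = l \<and> (\<forall>\<sigma>\<in>{1, -1}. \<bar>T B \<sigma> - T {} \<sigma>\<bar> \<le> real l * ((2 ^ n) ^ k * \<delta>))"
  using l
proof (induction l)
  case 0
  then show ?case by (intro exI[of _ "{}"]) simp
next
  case (Suc l)
  then obtain B where B: "B \<subseteq> {..<n}" "card B = l"
    "\<And>\<sigma>. \<sigma> \<in> {1, -1} \<Longrightarrow> \<bar>T B \<sigma> - T {} \<sigma>\<bar> \<le> real l * ((2 ^ n) ^ k * \<delta>)" by auto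
  have "3 * card B \<le> 2 * n" using Suc.prems B(2) by simp
  from ex_low_influence[OF B(1) this n] obtain j where j: "j < n" "j \<notin> B" "(\<Prod>i<k. root t (infl B j i)) \<le> \<delta>" .
  have "\<bar>T (insert j B) \<sigma> - T {} \<sigma>\<bar> \<le> real (Suc l) * ((2 ^ n) ^ k * \<delta>)" if "\<sigma> \<in> {1, -1}" for \<sigma>
  proof -
    have "\<bar>T (insert j B) \<sigma> - T B \<sigma>\<bar> \<le> (2 ^ n) ^ k * (\<Prod>i<k. root t (infl B j i))"
      using that by (intro T_increment[OF B(1) j(1,2)]) auto
    also have "\<dots> \<le> (2 ^ n) ^ k * \<delta>" using j(3) by (intro mult_left_mono) auto
    finally show ?thesis using B(3)[OF that] by (simp add: algebra_simps)
  qed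
  moreover have "card (insert j B) = Suc l"
    using B j finite_subset[OF B(1)] by simp
  ultimately show ?case using B(1) j(1) by (intro exI[of _ "insert j B"]) auto
qed

lemma W_eq_0: "W B \<sigma> x = 0" if "finite B" "\<bar>\<sigma>\<bar> = 1" "j \<in> B" "(\<Prod>i<k. eps j (x i)) \<noteq> \<sigma>"
proof -
  have "1 + \<sigma> * (\<Prod>i<k. eps j (x i)) = 0"
    using abs_prod_eps[of j x] that(2,4) by (auto simp: abs_if split: if_splits)
  then show ?thesis unfolding W_def using that by (intro prod_zero) auto
qed

text \<open>Both walks start at the same uniform average. At \<open>B\<close> one is at most
  \<open>1/3\<close> and the other at least \<open>2/3\<close> of the total mass, so twice
  \<open>l\<close> increments cover a gap of \<open>1/3\<close>.\<close>

lemma distinguishing_bound: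
  assumes n: "n > 0"
    and low: "\<And>B x. B \<subseteq> {..<n} \<Longrightarrow> 2 * n < 3 * card B \<Longrightarrow> x \<in> inputs \<Longrightarrow>
      (\<And>j. j \<in> B \<Longrightarrow> (\<Prod>i<k. eps j (x i)) = 1) \<Longrightarrow> G x \<le> 1 / 3"
    and high: "\<And>B x. B \<subseteq> {..<n} \<Longrightarrow> 2 * n < 3 * card B \<Longrightarrow> x \<in> inputs \<Longrightarrow>
      (\<And>j. j \<in> B \<Longrightarrow> (\<Prod>i<k. eps j (x i)) = -1) \<Longrightarrow> 2 / 3 \<le> G x"
  shows "1 \<le> 6 * real n * \<delta>"
proof -
  \<comment> \<open>The least integer above \<open>2n/3\<close>; it does not exceed \<open>n\<close>
    because \<open>n > 0\<close>.\<close>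
  define l where "l = 2 * n div 3 + 1"
  have l: "3 * l \<le> 2 * n + 3" "2 * n < 3 * l" "l \<le> n"
    unfolding l_def using n by presburger+
  obtain B where B: "B \<subseteq> {..<n}" "card B = l"
    "\<And>\<sigma>. \<sigma> \<in> {1, -1} \<Longrightarrow> \<bar>T B \<sigma> - T {} \<sigma>\<bar> \<le> real l * ((2 ^ n) ^ k * \<delta>)"
    using greedy[OF n l(1)] by auto
  have finB: "finite B" using B(1) finite_subset by blast
  have c: "2 * n < 3 * card B" using B(2) l(2) by simp
  have total: "(\<Sum>x\<in>inputs. W B \<sigma> x) = (2 ^ n) ^ k" for \<sigma>
  proof -
    have "(\<Sum>x\<in>inputs. W B \<sigma> x) = (\<Sum>w\<in>PiE {..<k} (\<lambda>_. Pow B). \<Sum>y\<in>PiE {..<k} (\<lambda>_. Pow ({..<n} - B)). W B \<sigma> w)"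
      unfolding inputs_def sum_PiE_Pow_split[OF B(1)]
    proof (intro sum.cong refl)
      fix w y assume "w \<in> PiE {..<k} (\<lambda>_. Pow B)" and y: "y \<in> PiE {..<k} (\<lambda>_. Pow ({..<n} - B))"
      have "eps j' (w i \<union> y i) = eps j' (w i)" if "i < k" "j' \<in> B" for i j'
        using y that by (auto simp: eps_def PiE_iff)
      then show "W B \<sigma> (\<lambda>i\<in>{..<k}. w i \<union> y i) = W B \<sigma> w" by (simp add: W_def)
    qed
    also have "\<dots> = real (card (PiE {..<k} (\<lambda>_. Pow ({..<n} - B)))) * (\<Sum>w\<in>PiE {..<k} (\<lambda>_. Pow B). W B \<sigma> w)"
      by (simp add: sum_distrib_left)
    also have "(\<Sum>w\<in>PiE {..<k} (\<lambda>_. Pow B). W B \<sigma> w) = (2 ^ card B) ^ k"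
      unfolding W_def using k by (intro sum_parity_weight finB) auto
    also have "real (card (PiE {..<k} (\<lambda>_. Pow ({..<n} - B)))) = (2 ^ (n - card B)) ^ k"
      using B(1) finB by (simp add: card_PiE card_Pow card_Diff_subset)
    also have "(2 ^ (n - card B)) ^ k * (2 ^ card B) ^ k = ((2::real) ^ n) ^ k"
      using B(2) l(3) by (simp flip: power_mult_distrib power_add)
    finally show ?thesis .
  qed
  have "T B 1 \<le> (\<Sum>x\<in>inputs. W B 1 x * (1 / 3))"
    unfolding T_def
  proof (rule sum_mono)
    fix x assume x: "x \<in> inputs"
    show "W B 1 x * G x \<le> W B 1 x * (1 / 3)"
    proof (cases "\<forall>j\<in>B. (\<Prod>i<k. eps j (x i)) = 1")
      case True
      then show ?thesis by (intro mult_left_mono low[OF B(1) c x] W_nonneg) auto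
    next
      case False
      then obtain j where "j \<in> B" "(\<Prod>i<k. eps j (x i)) \<noteq> 1" by auto
      then show ?thesis using W_eq_0[OF finB, of 1 j x] by simp
    qed
  qed
  then have up: "T B 1 \<le> (2 ^ n) ^ k * (1 / 3)" unfolding sum_distrib_right[symmetric] total .
  have "(\<Sum>x\<in>inputs. W B (-1) x * (2 / 3)) \<le> T B (-1)"
    unfolding T_def
  proof (rule sum_mono)
    fix x assume x: "x \<in> inputs"
    show "W B (-1) x * (2 / 3) \<le> W B (-1) x * G x"
    proof (cases "\<forall>j\<in>B. (\<Prod>i<k. eps j (x i)) = -1")
      case True
      then show ?thesis by (intro mult_left_mono high[OF B(1) c x] W_nonneg) auto
    next
      case False
      then obtain j where "j \<in> B" "(\<Prod>i<k. eps j (x i)) \<noteq> -1" by auto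
      then show ?thesis using W_eq_0[OF finB, of "-1" j x] by simp
    qed
  qed
  then have lo: "(2 ^ n) ^ k * (2 / 3) \<le> T B (-1)" unfolding sum_distrib_right[symmetric] total .
  have "T {} 1 = T {} (-1)" by (simp add: T_def W_def)
  then have "(2 ^ n) ^ k * (1 / 3) \<le> 2 * (real l * ((2 ^ n) ^ k * \<delta>))"
    using B(3)[of 1, simplified] B(3)[of "-1", simplified] up lo by linarith
  then have "(2 ^ n) ^ k * 1 \<le> (2 ^ n) ^ k * (6 * real l * \<delta>)" by (simp add: algebra_simps)
  then have "1 \<le> 6 * real l * \<delta>" by (subst (asm) mult_le_cancel_left_pos) auto
  also have "\<dots> \<le> 6 * real n * \<delta>"
    using l(3) by (intro mult_right_mono) (auto simp: \<delta>_def)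
  finally show ?thesis .
qed

text \<open>Raising the hypothesis to the power \<open>t/k\<close> cancels the exponent
  \<open>k/t\<close> of \<open>\<delta>\<close> and makes the bound linear in \<open>\<mu>\<close>.
  Since \<open>t/k \<le> 1\<close>, the constant 6 only shrinks.\<close>

lemma cost_lower_bound:
  assumes n: "n > 0" and tk: "t \<le> k" and d: "1 \<le> 6 * real n * \<delta>"
  shows "1 / 432 * real k * real n powr (1 - real t / real k) \<le> real (\<Sum>i<k. m i)"
proof -
  have \<mu>0: "0 \<le> \<mu>" by (simp add: \<mu>_def sum_nonneg)
  define Y where "Y = 72 * \<mu> / real n"
  have Y: "0 \<le> Y" using \<mu>0 by (simp add: Y_def)
  have "1 \<le> (6 * real n * \<delta>) powr (real t / real k)"
    using d by (intro ge_one_powr_ge_zero) auto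
  also have "\<dots> = 6 powr (real t / real k) * real n powr (real t / real k) * (Y powr (real k / real t)) powr (real t / real k)"
    by (simp add: \<delta>_def Y_def powr_mult)
  also have "(Y powr (real k / real t)) powr (real t / real k) = Y"
    using Y t k by (simp add: powr_powr)
  also have "6 powr (real t / real k) * real n powr (real t / real k) * Y \<le> 6 powr 1 * real n powr (real t / real k) * Y"
    using tk k Y by (intro mult_right_mono powr_mono) auto
  also have "\<dots> = 432 * \<mu> * (real n powr (real t / real k) / real n)"
    by (simp add: Y_def)
  finally have "1 \<le> 432 * \<mu> * (real n powr (real t / real k) / real n)" .
  then have "real n \<le> 432 * \<mu> * real n powr (real t / real k)"
    using n by (simp add: field_simps)
  then have "real n / real n powr (real t / real k) \<le> 432 * \<mu>"
    using n by (simp add: field_simps)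
  then have "real n powr (1 - real t / real k) \<le> 432 * \<mu>"
    using n by (simp add: powr_diff)
  then show ?thesis using k by (simp add: \<mu>_def field_simps)
qed

end

section \<open>The communication bounds\<close>

lemma classical_one_bit: "classical_one_bit_SMP_solves_GP k n"
proof (cases "n = 0")
  case True
  \<comment> \<open>No input of length 0 satisfies the promise, and the uniform choice of a
    coordinate would have no support.\<close>
  then show ?thesis
    by (auto simp: classical_one_bit_SMP_solves_GP_def GP_promise_def xor_weight_def)
next
  case False
  define par where "par f = odd (card {i. i < k \<and> f i})" for f
  have "2 / 3 \<le> measure_pmf.prob (pmf_of_set {..<n})
      {r. par (\<lambda>i. if i < k then x i ! r else False) = GP k n x}"
    if x: "GP_promise k n x" for x
  proof -
    define D where "D = {j. j < n \<and> odd (card {i. i < k \<and> x i ! j})}"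
    have D: "D \<subseteq> {..<n}" "card D = xor_weight k n x"
      by (auto simp: D_def xor_weight_def)
    define out where "out r = par (\<lambda>i. if i < k then x i ! r else False)" for r
    have out: "out r \<longleftrightarrow> r \<in> D" if "r < n" for r
    proof -
      have "{i. i < k \<and> (if i < k then x i ! r else False)} = {i. i < k \<and> x i ! r}" by auto
      then show ?thesis using that by (simp only: out_def par_def D_def mem_Collect_eq simp_thms)
    qed
    have prob: "measure_pmf.prob (pmf_of_set {..<n}) {r. out r = GP k n x} =
       real (card ({..<n} \<inter> {r. out r = GP k n x})) / real n"
      using False by (subst measure_pmf_of_set) (auto simp: lessThan_empty_iff)
    have "2 / 3 \<le> measure_pmf.prob (pmf_of_set {..<n}) {r. out r = GP k n x}"
    proof (cases "GP k n x")
      case True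
      then have "{..<n} \<inter> {r. out r = GP k n x} = D"
        using out D(1) by auto
      then show ?thesis
        using x True False unfolding prob by (auto simp: GP_promise_def GP_def D(2) field_simps)
    next
      case nGP: False
      then have "{..<n} \<inter> {r. out r = GP k n x} = {..<n} - D"
        using out by auto
      moreover have "card ({..<n} - D) = n - xor_weight k n x" "xor_weight k n x \<le> n"
        using D card_mono[OF _ D(1)] finite_subset[OF D(1)] by (auto simp: card_Diff_subset)
      ultimately show ?thesis
        using x nGP False unfolding prob by (auto simp: GP_promise_def GP_def field_simps)
    qed
    then show ?thesis by (simp only: out_def)
  qed
  then show ?thesis
    unfolding classical_one_bit_SMP_solves_GP_def
    by (intro exI[of _ "pmf_of_set {..<n}"] exI[of _ "\<lambda>_ r y. y ! r"] exI[of _ par]) simp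
qed

definition bits :: "nat \<Rightarrow> nat set \<Rightarrow> bool list" where
  "bits n X = map (\<lambda>j. j \<in> X) [0..<n]"

lemma prod_eps:
  fixes k :: nat
  shows "(\<Prod>i<k. eps j (x i)) = (if odd (card {i. i < k \<and> j \<in> x i}) then -1 else 1)"
proof -
  have "(\<Prod>i<k. eps j (x i)) = (\<Prod>i\<in>{i. i < k \<and> j \<in> x i}. -1)"
    by (intro prod.mono_neutral_cong_right) (auto simp: eps_def)
  then show ?thesis by simp
qed

lemma xor_weight_bits: "xor_weight k n (\<lambda>i. bits n (x i)) = card {j. j < n \<and> (\<Prod>i<k. eps j (x i)) = -1}"
  unfolding xor_weight_def prod_eps by (rule arg_cong[where f = card]) (auto simp: bits_def)

text \<open>The two effects sum to the identity, so only the diagonal survives, and it is the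
  product of the traces.\<close>

lemma trace_tensor_density:
  assumes d: "\<And>i. i < k \<Longrightarrow> Defs.density (2 ^ m i) (\<rho> i)"
    and povm: "\<And>a b. a \<in> multi_idx k m \<Longrightarrow> b \<in> multi_idx k m \<Longrightarrow> E a b + E' a b = (if a = b then 1 else 0)"
  shows "(\<Sum>a\<in>multi_idx k m. \<Sum>b\<in>multi_idx k m. E a b * (\<Prod>i<k. \<rho> i (b i) (a i))) +
    (\<Sum>a\<in>multi_idx k m. \<Sum>b\<in>multi_idx k m. E' a b * (\<Prod>i<k. \<rho> i (b i) (a i))) = 1"
proof -
  have fin: "finite (multi_idx k m)" unfolding multi_idx_def by (intro finite_PiE) auto
  have "(\<Sum>a\<in>multi_idx k m. \<Sum>b\<in>multi_idx k m. E a b * (\<Prod>i<k. \<rho> i (b i) (a i))) +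
    (\<Sum>a\<in>multi_idx k m. \<Sum>b\<in>multi_idx k m. E' a b * (\<Prod>i<k. \<rho> i (b i) (a i))) =
    (\<Sum>a\<in>multi_idx k m. \<Sum>b\<in>multi_idx k m. (E a b + E' a b) * (\<Prod>i<k. \<rho> i (b i) (a i)))"
    by (simp only: sum.distrib distrib_right)
  also have "\<dots> = (\<Sum>a\<in>multi_idx k m. \<Sum>b\<in>multi_idx k m. if a = b then (\<Prod>i<k. \<rho> i (b i) (a i)) else 0)"
    by (intro sum.cong refl) (simp add: povm)
  also have "\<dots> = (\<Sum>a\<in>multi_idx k m. \<Prod>i<k. \<rho> i (a i) (a i))"
    using fin by (intro sum.cong refl) (simp add: sum.delta)
  also have "\<dots> = (\<Prod>i<k. \<Sum>a<2 ^ m i. \<rho> i a a)"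
    unfolding multi_idx_def by (rule prod_sum_PiE[symmetric]) auto
  also have "\<dots> = 1"
    using d by (intro prod.neutral) (simp add: Defs.density_def)
  finally show ?thesis .
qed

lemma quantum_SMP_lower_bound:
  assumes hk: "2 \<le> k" and ht: "2 \<le> t" "t \<le> k"
    and hSh: "finite Sh" "\<And>S. S \<in> Sh \<Longrightarrow> S \<subseteq> {..<k} \<and> card S = t"
    and solves: "quantum_SMP_solves_GP k n Sh m"
  shows "1 / 432 * real k * real n powr (1 - real t / real k) \<le> real (\<Sum>i<k. m i)"
proof (cases "n = 0")
  case True
  then show ?thesis by (simp add: sum_nonneg)
next
  case False
  let ?I = "multi_idx k m"
  obtain P :: "nat set \<Rightarrow> nat pmf" and \<rho> E where prot:
    "(\<forall>i<k. \<forall>y r. length y = n \<longrightarrow> Defs.density (2 ^ m i) (\<rho> i y r)) \<and>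
     psd_on ?I (E False) \<and> psd_on ?I (E True) \<and>
     (\<forall>a\<in>?I. \<forall>b\<in>?I. E False a b + E True a b = (if a = b then 1 else 0)) \<and>
     (\<forall>x. GP_promise k n x \<longrightarrow>
        measure_pmf.expectation (Pi_pmf Sh 0 P)
          (\<lambda>r. Re (\<Sum>a\<in>?I. \<Sum>b\<in>?I. E (GP k n x) a b *
            (\<Prod>i<k. \<rho> i (x i) (\<lambda>S. if i \<in> S then r S else 0) (b i) (a i)))) \<ge> 2 / 3)"
    using solves unfolding quantum_SMP_solves_GP_def by blast
  have dens: "Defs.density (2 ^ m i) (\<rho> i y r)" if "i < k" "length y = n" for i y r
    using prot that by blast
  have hpsd: "psd_on ?I (E False)" "psd_on ?I (E True)" using prot by blast+
  have hpovm: "E False a b + E True a b = (if a = b then 1 else 0)" if "a \<in> ?I" "b \<in> ?I" for a b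
    using prot that by blast
  have succ: "2 / 3 \<le> measure_pmf.expectation (Pi_pmf Sh 0 P)
      (\<lambda>r. Re (\<Sum>a\<in>?I. \<Sum>b\<in>?I. E (GP k n x) a b *
        (\<Prod>i<k. \<rho> i (x i) (\<lambda>S. if i \<in> S then r S else 0) (b i) (a i))))"
    if "GP_promise k n x" for x
    using prot that by blast
  \<comment> \<open>Strings outside \<open>Sh\<close> are read as 0, which makes locality hold for
    every \<open>r\<close>. On the support of \<open>Pi_pmf Sh 0 P\<close> those strings are 0
    anyway, so the success probabilities are unchanged.\<close>
  define \<rho>' where "\<rho>' i X r = \<rho> i (bits n X) (\<lambda>S. if S \<in> Sh \<and> i \<in> S then r S else 0)"
    for i X and r :: "nat set \<Rightarrow> nat"
  have len: "length (bits n X) = n" for X by (simp add: bits_def)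
  interpret shared_protocol n k t m Sh P \<rho>' "E True" "E False"
  proof
    show "\<rho>' i X r = \<rho>' i X r'"
      if "i < k" "\<And>S. S \<in> Sh \<Longrightarrow> i \<in> S \<Longrightarrow> r S = r' S" for i X r r'
      unfolding \<rho>'_def by (intro arg_cong[where f = "\<rho> i (bits n X)"] ext) (simp add: that)
    show "E True a b + E False a b = (if a = b then 1 else 0)" if "a \<in> ?I" "b \<in> ?I" for a b
      using hpovm[OF that] by (simp add: add.commute)
  qed (use hk ht hSh hpsd dens len in \<open>auto simp: \<rho>'_def\<close>)
  define out where "out v x r = Re (\<Sum>a\<in>?I. \<Sum>b\<in>?I. E v a b * (\<Prod>i<k. \<rho>' i (x i) r (b i) (a i)))" for v x r
  have acc: "accept x = out True x" for x by (simp add: out_def accept_def fun_eq_iff)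
  have succ': "2 / 3 \<le> measure_pmf.expectation rand (out (GP k n (\<lambda>i. bits n (x i))) x)"
    if pr: "GP_promise k n (\<lambda>i. bits n (x i))" for x
  proof -
    have "measure_pmf.expectation rand (out (GP k n (\<lambda>i. bits n (x i))) x) =
       measure_pmf.expectation (Pi_pmf Sh 0 P)
             (\<lambda>r. Re (\<Sum>a\<in>?I. \<Sum>b\<in>?I.
                   E (GP k n (\<lambda>i. bits n (x i))) a b *
                   (\<Prod>i<k. \<rho> i (bits n (x i)) (\<lambda>S. if i \<in> S then r S else 0) (b i) (a i))))"
      unfolding rand_def
    proof (rule integral_cong_AE)
      show "AE r in measure_pmf (Pi_pmf Sh 0 P). out (GP k n (\<lambda>i. bits n (x i))) x r =
         Re (\<Sum>a\<in>?I. \<Sum>b\<in>?I. E (GP k n (\<lambda>i. bits n (x i))) a b *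
                   (\<Prod>i<k. \<rho> i (bits n (x i)) (\<lambda>S. if i \<in> S then r S else 0) (b i) (a i)))"
        unfolding AE_measure_pmf_iff
      proof
        fix r assume r: "r \<in> set_pmf (Pi_pmf Sh 0 P)"
        have "\<forall>S. S \<notin> Sh \<longrightarrow> r S = 0"
          using subsetD[OF set_Pi_pmf_subset[OF hSh(1)] r] by simp
        then have "(\<lambda>S. if S \<in> Sh \<and> i \<in> S then r S else 0) = (\<lambda>S. if i \<in> S then r S else 0)" for i
          by auto
        then show "out (GP k n (\<lambda>i. bits n (x i))) x r =
         Re (\<Sum>a\<in>?I. \<Sum>b\<in>?I. E (GP k n (\<lambda>i. bits n (x i))) a b *
                   (\<Prod>i<k. \<rho> i (bits n (x i)) (\<lambda>S. if i \<in> S then r S else 0) (b i) (a i)))"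
          unfolding out_def \<rho>'_def by simp
      qed
    qed simp_all
    then show ?thesis using succ[OF pr] by simp
  qed
  \<comment> \<open>This turns success on inputs of value 0 into acceptance probability at most
    \<open>1/3\<close>.\<close>
  have compl: "out True x r = 1 - out False x r" if x: "x \<in> inputs" for x r
  proof -
    have "Defs.density (2 ^ m i) (\<rho>' i (x i) r)" if "i < k" for i
      using dens[OF that len] by (simp add: \<rho>'_def)
    from arg_cong[where f = Re, OF trace_tensor_density[where \<rho> = "\<lambda>i. \<rho>' i (x i) r" and E = "E False" and E' = "E True", OF this hpovm]]
    have "out False x r + out True x r = 1"
      unfolding out_def by (simp only: plus_complex.sel one_complex.sel)
    then show ?thesis by simp
  qed
  have "1 \<le> 6 * real n * \<delta>"
  proof (rule distinguishing_bound)
    show "n > 0" using False by simp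
  next
    fix B x
    assume B: "B \<subseteq> {..<n}" "2 * n < 3 * card B" and x: "x \<in> inputs"
      and even: "\<And>j. j \<in> B \<Longrightarrow> (\<Prod>i<k. eps j (x i)) = 1"
    \<comment> \<open>Odd parities can occur only outside \<open>B\<close>, that is in fewer than
      \<open>n/3\<close> places, whatever the input does there; so the promise holds with value
      0.\<close>
    have "card {j. j < n \<and> (\<Prod>i<k. eps j (x i)) = -1} \<le> card ({..<n} - B)"
      using even by (intro card_mono) force+
    also have "card ({..<n} - B) = n - card B" using B(1) finite_subset[OF B(1)] by (simp add: card_Diff_subset)
    finally have "card {j. j < n \<and> (\<Prod>i<k. eps j (x i)) = -1} \<le> n - card B" .
    moreover have "card B \<le> n" using card_mono[OF _ B(1)] by simp
    ultimately have w: "3 * xor_weight k n (\<lambda>i. bits n (x i)) < n"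
      unfolding xor_weight_bits using B(2) by linarith
    then have pr: "GP_promise k n (\<lambda>i. bits n (x i))" and gp: "\<not> GP k n (\<lambda>i. bits n (x i))"
      by (auto simp: GP_promise_def GP_def len)
    have "G x = measure_pmf.expectation rand (\<lambda>r. 1 - out False x r)"
      unfolding G_def acc compl[OF x, abs_def] ..
    also have "\<dots> = 1 - measure_pmf.expectation rand (out False x)"
    proof -
      have "integrable (measure_pmf rand) (\<lambda>r. 1 - out True x r)"
        using integrable_accept[OF x] by (simp add: acc)
      moreover have "(\<lambda>r. 1 - out True x r) = out False x"
        by (rule ext) (simp add: compl[OF x])
      ultimately have "integrable (measure_pmf rand) (out False x)" by simp
      then show ?thesis by simp
    qed
    finally show "G x \<le> 1 / 3" using succ'[OF pr] gp by simp
  next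
    fix B x
    assume B: "B \<subseteq> {..<n}" "2 * n < 3 * card B" and x: "x \<in> inputs"
      and odd: "\<And>j. j \<in> B \<Longrightarrow> (\<Prod>i<k. eps j (x i)) = -1"
    have "card B \<le> card {j. j < n \<and> (\<Prod>i<k. eps j (x i)) = -1}"
      using odd B(1) by (intro card_mono) auto
    then have w: "2 * n < 3 * xor_weight k n (\<lambda>i. bits n (x i))"
      unfolding xor_weight_bits using B(2) by linarith
    then have pr: "GP_promise k n (\<lambda>i. bits n (x i))" and gp: "GP k n (\<lambda>i. bits n (x i))"
      by (auto simp: GP_promise_def GP_def len)
    show "2 / 3 \<le> G x" using succ'[OF pr] gp by (simp add: G_def acc)
  qed
  then show ?thesis using cost_lower_bound False ht(2) by simp
qed

theorem theorem2:
  shows "(\<forall>k n. 3 \<le> k \<longrightarrow> classical_one_bit_SMP_solves_GP k n) \<and>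
         (\<exists>c>0. \<forall>k n t m. 3 \<le> k \<longrightarrow> 2 \<le> t \<longrightarrow> t \<le> k - 1 \<longrightarrow>
             quantum_SMP_solves_GP k n (tsubsets k t) m \<longrightarrow>
             real (\<Sum>i<k. m i) \<ge> c * real k * real n powr (1 - real t / real k)) \<and>
         (\<exists>c>0. \<forall>k n m. 3 \<le> k \<longrightarrow>
             quantum_SMP_solves_GP k n {} m \<longrightarrow>
             real (\<Sum>i<k. m i) \<ge> c * real k * real n powr (1 - 2 / real k))"
proof (intro conjI)
  show "\<forall>k n. 3 \<le> k \<longrightarrow> classical_one_bit_SMP_solves_GP k n"
    using classical_one_bit by simp
  have fin: "finite (tsubsets k t)" for k t
    by (rule finite_subset[of _ "Pow {..<k}"]) (auto simp: tsubsets_def)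
  show "\<exists>c>0. \<forall>k n t m. 3 \<le> k \<longrightarrow> 2 \<le> t \<longrightarrow> t \<le> k - 1 \<longrightarrow>
             quantum_SMP_solves_GP k n (tsubsets k t) m \<longrightarrow>
             real (\<Sum>i<k. m i) \<ge> c * real k * real n powr (1 - real t / real k)"
  proof (intro exI[of _ "1 / 432"] conjI allI impI)
    fix k n t :: nat and m
    assume "3 \<le> k" "2 \<le> t" "t \<le> k - 1" "quantum_SMP_solves_GP k n (tsubsets k t) m"
    then show "real (\<Sum>i<k. m i) \<ge> 1 / 432 * real k * real n powr (1 - real t / real k)"
      by (intro quantum_SMP_lower_bound[OF _ _ _ fin]) (auto simp: tsubsets_def)
  qed simp
  show "\<exists>c>0. \<forall>k n m. 3 \<le> k \<longrightarrow> quantum_SMP_solves_GP k n {} m \<longrightarrow>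
             real (\<Sum>i<k. m i) \<ge> c * real k * real n powr (1 - 2 / real k)"
  proof (intro exI[of _ "1 / 432"] conjI allI impI)
    fix k n :: nat and m
    assume "3 \<le> k" "quantum_SMP_solves_GP k n {} m"
    \<comment> \<open>The empty family vacuously consists of sets of size 2, so the bound applies
      with \<open>t = 2\<close>.\<close>
    then show "real (\<Sum>i<k. m i) \<ge> 1 / 432 * real k * real n powr (1 - 2 / real k)"
      using quantum_SMP_lower_bound[of k 2 "{}" n m] by simp
  qed simp
qed

end
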